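(* Let $x,x_1,x_2$ be roots of unity with $x\ne1$, let $a\in\mathbb{C}\setminus\mathbb{Z}$, and let $p_1,p_2,q\in\mathbb{N}$ with $(p_1,x_1)\ne(1,1)$, $(p_2,x_2)\ne(1,1)$ and $(q,xx_1x_2)\ne(1,1)$. Writing $C_k:=(-1)^k\mathrm{Li}_{k+1}(x;1-a)-x\,\mathrm{Li}_{k+1}(x^{-1};a)$ for $k\ge0$, we have \begin{align*} &(-1)^{p_1+p_2+q+1}\tilde{S}^{(-a)}_{p_1,p_2;q}\big(x_1^{-1},x_2^{-1};xx_1x_2\big)-(x_1x_2)^{-1}\tilde{S}^{(a-1)}_{p_1,p_2;q}\big(x_1,x_2;(xx_1x_2)^{-1}\big)\\ &=(x_1x_2)^{-1}\mathrm{Li}_{p_1}(x_1;a)\mathrm{Li}_{p_2}(x_2;a)\mathrm{Li}_q\big((xx_1x_2)^{-1}\big)-(x_1x_2)^{-1}\mathrm{Li}_{p_1}(x_1;a)\tilde{S}^{(a-1)}_{p_2;q}\big(x_2;(xx_1x_2)^{-1}\big)\\ &\quad-(x_1x_2)^{-1}\mathrm{Li}_{p_2}(x_2;a)\tilde{S}^{(a-1)}_{p_1;q}\big(x_1;(xx_1x_2)^{-1}\big)+(-1)^q(x_1x_2)^{-1}\mathrm{Li}_{p_1}(x_1;a)\mathrm{Li}_{p_2}(x_2;a)\mathrm{Li}_q(xx_1x_2)\\ &\quad+(-1)^{q+p_2}x_1^{-1}\mathrm{Li}_{p_1}(x_1;a)\tilde{S}^{(-a)}_{p_2;q}\big(x_2^{-1};xx_1x_2\big)+(-1)^{q+p_1}x_2^{-1}\mathrm{Li}_{p_2}(x_2;a)\tilde{S}^{(-a)}_{p_1;q}\big(x_1^{-1};xx_1x_2\big)\\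 &\quad+(-1)^q\sum_{k=0}^{p_1+p_2-1}\binom{p_1+p_2+q-k-2}{q-1}C_k\,(xx_1x_2)^{-1}\mathrm{Li}_{p_1+p_2+q-k-1}(xx_1x_2;a)\\ &\quad+(-1)^q\sum_{\substack{k_1+k_2\leq p_2-1\\ k_1,k_2\geq0}}\binom{k_2+p_1-1}{p_1-1}\binom{p_2+q-k_1-k_2-2}{q-1}(xx_1x_2)^{-1}C_{k_1}(-1)^{k_2}\mathrm{Li}_{k_2+p_1}(x_1)\mathrm{Li}_{p_2+q-k_1-k_2-1}(xx_1x_2;a)\\ &\quad+(-1)^q\sum_{\substack{k_1+k_2\leq p_2-1\\ k_1,k_2\geq0}}\binom{k_2+p_1-1}{p_1-1}\binom{p_2+q-k_1-k_2-2}{q-1}C_{k_1}(-1)^{p_1}R^{(a)}_{k_2+p_1;p_2+q-k_1-k_2-1}\big(x_1^{-1};xx_1x_2\big)\\ &\quad+(-1)^q\sum_{\substack{k_1+k_2\leq p_1-1\\ k_1,k_2\geq0}}\binom{k_2+p_2-1}{p_2-1}\binom{p_1+q-k_1-k_2-2}{q-1}(xx_1x_2)^{-1}C_{k_1}(-1)^{k_2}\mathrm{Li}_{k_2+p_2}(x_2)\mathrm{Li}_{p_1+q-k_1-k_2-1}(xx_1x_2;a)\\ &\quad+(-1)^q\sum_{\substack{k_1+k_2\leq p_1-1\\ k_1,k_2\geq0}}\binom{k_2+p_2-1}{p_2-1}\binom{p_1+q-k_1-k_2-2}{q-1}C_{k_1}(-1)^{p_2}R^{(a)}_{k_2+p_2;p_1+q-k_1-k_2-1}\big(x_2^{-1};xx_1x_2\big)\\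 &\quad+\sum_{\substack{k_1+k_2=q\\ k_1,k_2\geq0}}(x_1x_2)^{-1}(-1)^q\binom{k_1+p_1-1}{p_1-1}\binom{k_2+p_2-1}{p_2-1}\mathrm{Li}_{k_1+p_1}(x_1;a)\mathrm{Li}_{k_2+p_2}(x_2;a)\\ &\quad+\sum_{\substack{k_1+k_2+k_3=q-1\\ k_1,k_2,k_3\geq0}}(-1)^{k_2+k_3}\binom{k_2+p_1-1}{p_1-1}\binom{k_3+p_2-1}{p_2-1}\mathrm{Li}_{k_2+p_1}(x_1;a)\mathrm{Li}_{k_3+p_2}(x_2;a)(x_1x_2)^{-1}\left((-1)^{k_1}\mathrm{Li}_{k_1+1}(x)-\mathrm{Li}_{k_1+1}\big(x^{-1}\big)\right). \end{align*}
   Context: For $|w|\le1$, $m\in\mathbb{N}$ with $(m,w)\ne(1,1)$, $b\in\mathbb{C}\setminus\{0,-1,-2,\dots\}$: $\mathrm{Li}_m(w;b)=\sum_{n\ge1}\frac{w^n}{(n+b-1)^m}$, $\mathrm{Li}_m(w)=\sum_{n\ge1}\frac{w^n}{n^m}$. For $n\ge0$: $\zeta_n(p;w;b)=\sum_{k=1}^n\frac{w^k}{(k+b)^p}$, $\zeta_n(p;w)=\sum_{k=1}^n\frac{w^k}{k^p}$. For roots of unity $u_1,\dots,u_r,v$, positive integers $p_1,\dots,p_r,q$ with $(q,v)\ne(1,1)$ and $b\in\mathbb{C}\setminus\mathbb{Z}$: $\tilde S^{(b)}_{p_1,\dots,p_r;q}(u_1,\dots,u_r;v)=\sum_{n\ge1}\frac{\zeta_n(p_1;u_1;b)\cdots\zeta_n(p_r;u_r;b)}{n^q}v^n$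 and $R^{(b)}_{p;q}(u;v)=\sum_{n\ge1}\frac{\zeta_n(p;u)}{(n+b)^q}v^n$. *)

theory Defs
  imports "HOL-Complex_Analysis.Complex_Analysis"
begin

text \<open>
  All series over \<open>n \<ge> 1\<close> are written with \<^const>\<open>suminf\<close> over \<open>n \<ge> 0\<close> and the index shifted to
  \<^term>\<open>Suc n\<close>. Since \<^const>\<open>suminf\<close> is the limit of the partial sums, the conditionally convergent
  cases (exponent 1, root of unity different from 1) are covered.
\<close>

definition root_of_unity :: "complex \<Rightarrow> bool" where
  "root_of_unity u \<longleftrightarrow> (\<exists>N>0. u ^ N = 1)"

definition polylog :: "nat \<Rightarrow> complex \<Rightarrow> complex" where
  "polylog m w = (\<Sum>n. w ^ Suc n / of_nat (Suc n) ^ m)"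

text \<open>The denominator \<open>(n + b - 1)\<^sup>m\<close> makes \<^term>\<open>b = 1\<close>, not \<^term>\<open>b = 0\<close>, the ordinary polylogarithm;
  in \<open>zeta_shift\<close> and \<open>R_sum\<close> below the shift is by \<open>b\<close> itself.\<close>

definition polylog_shift :: "nat \<Rightarrow> complex \<Rightarrow> complex \<Rightarrow> complex" where
  "polylog_shift m w b = (\<Sum>n. w ^ Suc n / (of_nat (Suc n) + b - 1) ^ m)"

definition zeta_fin :: "nat \<Rightarrow> nat \<Rightarrow> complex \<Rightarrow> complex" where
  "zeta_fin n p w = (\<Sum>k=1..n. w ^ k / of_nat k ^ p)"

definition zeta_shift :: "nat \<Rightarrow> nat \<Rightarrow> complex \<Rightarrow> complex \<Rightarrow> complex" where
  "zeta_shift n p w b = (\<Sum>k=1..n. w ^ k / (of_nat k + b) ^ p)"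

text \<open>\<open>S_tilde b [p\<^sub>1, \<dots>, p\<^sub>r] q [u\<^sub>1, \<dots>, u\<^sub>r] v\<close>; the two lists are meant to have the same length.\<close>

definition S_tilde :: "complex \<Rightarrow> nat list \<Rightarrow> nat \<Rightarrow> complex list \<Rightarrow> complex \<Rightarrow> complex" where
  "S_tilde b ps q us v =
     (\<Sum>n. (\<Prod>(p, u)\<leftarrow>zip ps us. zeta_shift (Suc n) p u b) / of_nat (Suc n) ^ q * v ^ Suc n)"

definition R_sum :: "complex \<Rightarrow> nat \<Rightarrow> nat \<Rightarrow> complex \<Rightarrow> complex \<Rightarrow> complex" where
  "R_sum b p q u v =
     (\<Sum>n. zeta_fin (Suc n) p u / (of_nat (Suc n) + b) ^ q * v ^ Suc n)"

definition C_coeff :: "complex \<Rightarrow> complex \<Rightarrow> nat \<Rightarrow> complex" where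
  "C_coeff x a k =
     (-1) ^ k * polylog_shift (k + 1) x (1 - a) - x * polylog_shift (k + 1) (inverse x) a"

end

theory Submission
  imports Defs
begin

text \<open>
  Let \<open>\<phi>\<^sub>i(s) = \<Sum>\<^sub>k\<^sub>\<ge>\<^sub>0 x\<^sub>i\<^sup>k / (s + a + k)\<^bsup>p\<^sub>i\<^esup>\<close>. The identity is the residue theorem for
  \<open>\<phi>\<^sub>1(s) \<phi>\<^sub>2(s) s\<^bsup>-q\<^esup>\<close> against the kernel \<open>\<Sum>\<^sub>k x\<^sup>k / (s + k)\<close>, whose residue at an integer \<open>n\<close> is
  \<open>x\<^bsup>-n\<^esup>\<close>; it is obtained here without contour integrals. Cutting both series off at \<open>k = K\<close> leaves a
  rational function, and its values at the nonzero integers can be summed with weights \<open>x\<^bsup>-n\<^esup>\<close> term by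
  term from its partial fractions: the poles \<open>-a - k\<close> produce the \<^const>\<open>C_coeff\<close>, and the pole \<open>0\<close>
  contributes the Taylor coefficients of \<open>\<phi>\<^sub>1 \<phi>\<^sub>2\<close>. The series over \<open>n\<close> may converge only
  conditionally, so the limit \<open>K \<rightarrow> \<infinity>\<close> is interchanged with them by a tail estimate uniform in \<open>K\<close>,
  from summation by parts.
\<close>

section \<open>Interchanging the truncation limit with conditionally convergent series\<close>

text \<open>The way out is the shape of the truncated series at an integer \<open>m\<close>: up to
  the factor x_i^(-m) it is a sum of one two-sided sequence over the window from \<open>m\<close> to
  \<open>m + K\<close>, that is, a difference of two values of a bounded antidifference. Moving
  \<open>m\<close> by one changes only the two ends of the window, and the definition below records
  exactly this. The factors x_i^(-m) turn the kernel weight into (x x1 x2)^(-m); this is where the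
  condition on \<open>(q, x * x1 * x2)\<close> enters.

  A closed form in terms of \<open>C_coeff\<close> exists only for sums over all integers, 0
  included. The term at 0 which has to be taken out again is the Taylor coefficient of order
  \<open>q\<close>, the origin of the sum over k1 + k2 = q. Poles \<open>-a - k\<close> and
  \<open>-a - l\<close> with different \<open>k\<close>, \<open>l\<close> bring in powers of 1 / (l
  - k). Summed over \<open>l\<close>, the part \<open>l > k\<close> is cut off at
  \<open>K - k\<close> and tends to a polylogarithm, whereas the part \<open>l < k\<close> is a
  finite sum attached to \<open>k\<close> and produces \<open>R_sum\<close>.\<close>

text \<open>The term peaking at \<open>n + 1 = K\<close> is needed because at a negative integer \<open>-n\<close> the last summand of the
  truncated series, of index \<open>K\<close>, has denominator close to \<open>K - n\<close>.\<close>

definition slowly_varying :: "(nat \<Rightarrow> nat \<Rightarrow> complex) \<Rightarrow> bool" where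
  "slowly_varying F \<longleftrightarrow> (\<exists>c. \<forall>K n. norm (F K n) \<le> c \<and>
     norm (F K (Suc n) - F K n) \<le> c / real (Suc n) + c / (1 + \<bar>real K - real (Suc n)\<bar>))"

text \<open>The alternatives match \<open>1 / (n + b) ^ t\<close>: absolute convergence for
  \<open>t >= 2\<close>, where \<open>y = 1\<close> is allowed, and summation by parts for
  \<open>t = 1\<close>. The oscillating factor \<open>y ^ n\<close> is kept out of \<open>d\<close>,
  whose increments must be small in the second case.\<close>

definition dirichlet_weight :: "complex \<Rightarrow> (nat \<Rightarrow> complex) \<Rightarrow> bool" where
  "dirichlet_weight y d \<longleftrightarrow> norm y = 1 \<and> (\<exists>c. (\<forall>n. norm (d n) \<le> c / real (Suc n) ^ 2) \<or>
     y \<noteq> 1 \<and> (\<forall>n. norm (d n) \<le> c / real (Suc n) \<and> norm (d (Suc n) - d n) \<le> c / real (Suc n) ^ 2))"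

text \<open>Summation by parts against a geometric sequence. With \<open>1 - y\<close> as a factor
  on the left no quotients occur, and induction on \<open>L\<close> suffices.\<close>

lemma abel_identity:
  fixes y :: complex
  shows "(1 - y) * (\<Sum>n=M..<M+L. y ^ n * b n) =
    y ^ M * b M - y ^ (M + L) * b (M + L) + (\<Sum>n=M..<M+L. y ^ Suc n * (b (Suc n) - b n))"
proof (induction L)
  case (Suc L)
  define A where "A = (\<Sum>n=M..<M+L. y ^ n * b n)"
  define B where "B = (\<Sum>n=M..<M+L. y ^ Suc n * (b (Suc n) - b n))"
  have "(1 - y) * A = y ^ M * b M - y ^ (M + L) * b (M + L) + B"
    using Suc by (simp add: A_def B_def)
  moreover have "(1 - y) * (A + y ^ (M + L) * b (M + L)) = (1 - y) * A + (1 - y) * (y ^ (M + L) * b (M + L))"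
    by (rule distrib_left)
  ultimately have "(1 - y) * (A + y ^ (M + L) * b (M + L)) = y ^ M * b M - y ^ Suc (M + L) * b (Suc (M + L))
      + (B + y ^ Suc (M + L) * (b (Suc (M + L)) - b (M + L)))"
    by (simp add: algebra_simps)
  then show ?case by (simp add: A_def B_def)
qed simp

lemma sum_inverse_squares_le: "(\<Sum>n=M..<N. 1 / real (Suc n) ^ 2) \<le> 2 / real (Suc M)"
proof -
  \<comment> \<open>Subtracting the last reciprocal makes the bound inductive: each new term is at
    most the drop \<open>1 / t - 1 / (t + 1)\<close>.\<close>
  have *: "(\<Sum>n=M..<M+Suc L. 1 / real (Suc n) ^ 2) \<le> 2 / real (Suc M) - 1 / real (Suc (M + L))" for L
  proof (induction L)
    case 0
    then show ?case by (simp add: divide_simps power2_eq_square)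
  next
    case (Suc L)
    define t where "t = real (Suc (M + L))"
    have "t > 0" by (simp add: t_def)
    then have "1 / (t + 1) ^ 2 \<le> 1 / t - 1 / (t + 1)"
      by (simp add: divide_simps power2_eq_square)
    moreover have t': "real (Suc (M + Suc L)) = t + 1" by (simp add: t_def)
    moreover have "(\<Sum>n=M..<M+Suc (Suc L). 1 / real (Suc n) ^ 2) =
        (\<Sum>n=M..<M+Suc L. 1 / real (Suc n) ^ 2) + 1 / real (Suc (M + Suc L)) ^ 2"
      by simp
    ultimately show ?case using Suc.IH unfolding t' t_def[symmetric] by linarith
  qed
  show ?thesis
  proof (cases "M < N")
    case True
    then obtain L where N: "N = M + Suc L" using less_imp_Suc_add by fastforce
    have "0 \<le> 1 / real (Suc (M + L))" by simp
    then show ?thesis using *[of L] unfolding N by linarith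
  qed simp
qed

text \<open>On either side of the peak at \<open>K\<close> the terms are dominated by those of the
  sum of inverse squares, which is at most 2.\<close>

lemma sum_inverse_dist_squares_le:
  "(\<Sum>n=M..<N. 1 / (1 + \<bar>real K - real (Suc n)\<bar>) ^ 2) \<le> 4"
proof -
  let ?f = "\<lambda>n. 1 / (1 + \<bar>real K - real (Suc n)\<bar>) ^ 2"
  have "(\<Sum>n=M..<N. ?f n) \<le> (\<Sum>n\<in>{..<K} \<union> {K..<K+N}. ?f n)"
    by (rule sum_mono2) auto
  also have "\<dots> = (\<Sum>n<K. ?f n) + (\<Sum>n=K..<K+N. ?f n)"
    by (rule sum.union_disjoint) auto
  also have "(\<Sum>n<K. ?f n) = (\<Sum>n<K. 1 / real (Suc (K - Suc n)) ^ 2)"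
    by (rule sum.cong) (auto simp: of_nat_diff)
  also have "\<dots> = (\<Sum>n<K. 1 / real (Suc n) ^ 2)"
    by (rule sum.nat_diff_reindex)
  also have "\<dots> \<le> 2" using sum_inverse_squares_le[of 0 K] by (simp add: atLeast0LessThan)
  also have "(\<Sum>n=K..<K+N. ?f n) = (\<Sum>n=0..<N. ?f (n + K))"
    using sum.shift_bounds_nat_ivl[of ?f 0 K N] by (simp add: add.commute)
  also have "\<dots> \<le> (\<Sum>n=0..<N. 1 / real (Suc n) ^ 2)"
    by (intro sum_mono divide_left_mono power_mono) auto
  also have "\<dots> \<le> 2" using sum_inverse_squares_le[of 0 N] by simp
  finally show ?thesis by simp
qed

text \<open>The weight \<open>s = sqrt (M + 1)\<close> in the AM-GM inequality makes the bound independent of \<open>K\<close> and still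
  tend to \<open>0\<close> as \<open>M\<close> grows.\<close>

lemma sum_cross_le:
  "(\<Sum>n=M..<N. 1 / (real (Suc n) * (1 + \<bar>real K - real (Suc n)\<bar>))) \<le> 3 / sqrt (real (Suc M))"
proof -
  define s where "s = sqrt (real (Suc M))"
  have s: "s > 0" "s * s = real (Suc M)" by (auto simp: s_def)
  have *: "1 / (u * v) \<le> s / 2 * (1 / u ^ 2) + 1 / (2 * s) * (1 / v ^ 2)" if "u > 0" "v > 0" for u v :: real
  proof -
    have "0 \<le> (s / u - 1 / v) ^ 2 / (2 * s)" using s by simp
    also have "\<dots> = s / 2 * (1 / u ^ 2) + 1 / (2 * s) * (1 / v ^ 2) - 1 / (u * v)"
      using s that by (simp add: power2_eq_square field_simps)
    finally show ?thesis by simp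
  qed
  have "(\<Sum>n=M..<N. 1 / (real (Suc n) * (1 + \<bar>real K - real (Suc n)\<bar>))) \<le>
     (\<Sum>n=M..<N. s / 2 * (1 / real (Suc n) ^ 2) + 1 / (2 * s) * (1 / (1 + \<bar>real K - real (Suc n)\<bar>) ^ 2))"
    by (intro sum_mono *) auto
  also have "\<dots> = s / 2 * (\<Sum>n=M..<N. 1 / real (Suc n) ^ 2)
      + 1 / (2 * s) * (\<Sum>n=M..<N. 1 / (1 + \<bar>real K - real (Suc n)\<bar>) ^ 2)"
    by (simp add: sum.distrib sum_distrib_left)
  also have "\<dots> \<le> s / 2 * (2 / real (Suc M)) + 1 / (2 * s) * 4"
    using s by (intro add_mono mult_left_mono sum_inverse_squares_le sum_inverse_dist_squares_le) auto
  also have "\<dots> = 3 / s" unfolding s(2)[symmetric] using s(1) by (simp add: field_simps)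
  finally show ?thesis by (simp add: s_def)
qed

text \<open>The point is that \<open>c\<close> is chosen before \<open>K\<close>. In the conditional
  case the increments of \<open>d n * F K n\<close> are bounded by inverse squares plus a cross term
  from the peak at \<open>K\<close>; the cross term is what limits the rate to an inverse square
  root.\<close>

lemma slowly_varying_tail_bound:
  assumes "dirichlet_weight y d" "slowly_varying F"
  shows "\<exists>c. \<forall>K M N. norm (\<Sum>n=M..<N. y ^ n * d n * F K n) \<le> c / sqrt (real (Suc M))"
proof -
  from assms(2) obtain c2 where F: "\<And>K n. norm (F K n) \<le> c2"
    and dF: "\<And>K n. norm (F K (Suc n) - F K n) \<le> c2 / real (Suc n) + c2 / (1 + \<bar>real K - real (Suc n)\<bar>)"
    unfolding slowly_varying_def by blast
  have c2: "c2 \<ge> 0" using F[of 0 0] norm_ge_zero order_trans by blast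
  have y: "norm y = 1" using assms(1) by (simp add: dirichlet_weight_def)
  have sq: "1 / real (Suc M) \<le> 1 / sqrt (real (Suc M))" for M
    by (intro divide_left_mono) (auto simp: real_sqrt_le_iff intro!: real_le_lsqrt simp: power2_eq_square)
  consider (abs) c1 where "\<And>n. norm (d n) \<le> c1 / real (Suc n) ^ 2"
    | (cond) c1 where "y \<noteq> 1" "\<And>n. norm (d n) \<le> c1 / real (Suc n)"
        "\<And>n. norm (d (Suc n) - d n) \<le> c1 / real (Suc n) ^ 2"
    using assms(1) unfolding dirichlet_weight_def by blast
  then show ?thesis
  proof cases
    case abs
    have c1: "c1 \<ge> 0" using order_trans[OF norm_ge_zero abs[of 0]] by simp
    have "norm (\<Sum>n=M..<N. y ^ n * d n * F K n) \<le> 2 * (c1 * c2) / sqrt (real (Suc M))" for K M N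
    proof -
      have "norm (\<Sum>n=M..<N. y ^ n * d n * F K n) \<le> (\<Sum>n=M..<N. c1 * c2 * (1 / real (Suc n) ^ 2))"
      proof (rule sum_norm_le)
        fix n
        have "norm (y ^ n * d n * F K n) = norm (d n) * norm (F K n)"
          by (simp add: norm_mult norm_power y)
        also have "\<dots> \<le> c1 / real (Suc n) ^ 2 * c2"
          by (intro mult_mono abs F) (use c1 in auto)
        finally show "norm (y ^ n * d n * F K n) \<le> c1 * c2 * (1 / real (Suc n) ^ 2)" by simp
      qed
      also have "\<dots> = c1 * c2 * (\<Sum>n=M..<N. 1 / real (Suc n) ^ 2)" by (simp add: sum_distrib_left)
      also have "\<dots> \<le> c1 * c2 * (2 / real (Suc M))"
        using c1 c2 by (intro mult_left_mono sum_inverse_squares_le) auto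
      also have "\<dots> = 2 * (c1 * c2) * (1 / real (Suc M))" by simp
      also have "\<dots> \<le> 2 * (c1 * c2) * (1 / sqrt (real (Suc M)))"
        using c1 c2 by (intro mult_left_mono sq) auto
      finally show ?thesis by simp
    qed
    then show ?thesis by blast
  next
    case cond
    have c1: "c1 \<ge> 0" using order_trans[OF norm_ge_zero cond(2)[of 0]] by simp
    define c where "c = c1 * c2"
    have c: "c \<ge> 0" using c1 c2 by (simp add: c_def)
    have bound: "norm (\<Sum>n=M..<M+L. y ^ n * d n * F K n) \<le> 9 * c / norm (1 - y) / sqrt (real (Suc M))" for K M L
    proof -
      define b where "b n = d n * F K n" for n
      have b: "norm (b n) \<le> c * (1 / real (Suc n))" for n
      proof -
        have "norm (b n) \<le> c1 / real (Suc n) * c2" unfolding b_def norm_mult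
          by (intro mult_mono cond F) (use c1 in auto)
        then show ?thesis by (simp add: c_def)
      qed
      have db: "norm (b (Suc n) - b n) \<le> c * (2 * (1 / real (Suc n) ^ 2) + 1 / (real (Suc n) * (1 + \<bar>real K - real (Suc n)\<bar>)))" for n
      proof -
        have "b (Suc n) - b n = d (Suc n) * (F K (Suc n) - F K n) + (d (Suc n) - d n) * F K n"
          by (simp add: b_def algebra_simps)
        then have "norm (b (Suc n) - b n) \<le> norm (d (Suc n)) * norm (F K (Suc n) - F K n) + norm (d (Suc n) - d n) * norm (F K n)"
          by (metis norm_triangle_ineq norm_mult)
        also have "\<dots> \<le> (c1 / real (Suc n)) * (c2 / real (Suc n) + c2 / (1 + \<bar>real K - real (Suc n)\<bar>)) + c1 / real (Suc n) ^ 2 * c2"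
        proof (intro add_mono mult_mono dF F cond)
          have "norm (d (Suc n)) \<le> c1 / real (Suc (Suc n))" by (rule cond)
          also have "\<dots> \<le> c1 / real (Suc n)" using c1 by (intro divide_left_mono) auto
          finally show "norm (d (Suc n)) \<le> c1 / real (Suc n)" .
        qed (use c1 c2 in auto)
        also have "\<dots> = c * (2 * (1 / real (Suc n) ^ 2) + 1 / (real (Suc n) * (1 + \<bar>real K - real (Suc n)\<bar>)))"
          by (simp add: c_def power2_eq_square ring_distribs del: of_nat_Suc)
        finally show ?thesis .
      qed
      let ?r = "1 / sqrt (real (Suc M))"
      have "norm (1 - y) * norm (\<Sum>n=M..<M+L. y ^ n * b n)
          \<le> norm (b M) + norm (b (M + L)) + (\<Sum>n=M..<M+L. norm (b (Suc n) - b n))"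
      proof -
        have "norm (1 - y) * norm (\<Sum>n=M..<M+L. y ^ n * b n) = norm ((1 - y) * (\<Sum>n=M..<M+L. y ^ n * b n))"
          by (simp add: norm_mult)
        also have "\<dots> \<le> norm (y ^ M * b M) + norm (y ^ (M + L) * b (M + L)) + norm (\<Sum>n=M..<M+L. y ^ Suc n * (b (Suc n) - b n))"
          unfolding abel_identity by (meson norm_triangle_ineq norm_triangle_ineq4 order_trans add_mono order_refl)
        also have "norm (\<Sum>n=M..<M+L. y ^ Suc n * (b (Suc n) - b n)) \<le> (\<Sum>n=M..<M+L. norm (b (Suc n) - b n))"
          by (rule sum_norm_le) (simp add: norm_mult norm_power y)
        finally show ?thesis by (simp add: norm_mult norm_power y)
      qed
      \<comment> \<open>Each boundary term costs \<open>c * ?r\<close>, the inverse squares cost 2 *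
        2 and the cross term 3, hence the 9 below.\<close>
      also have "\<dots> \<le> c * ?r + c * ?r + c * (4 * ?r + 3 * ?r)"
      proof (intro add_mono)
        show "norm (b M) \<le> c * ?r" using b[of M] mult_left_mono[OF sq[of M] c] by linarith
        have "1 / real (Suc (M + L)) \<le> 1 / real (Suc M)" by (intro divide_left_mono) auto
        then have "1 / real (Suc (M + L)) \<le> ?r" using sq[of M] by linarith
        then show "norm (b (M + L)) \<le> c * ?r" using order_trans[OF b[of "M + L"] mult_left_mono[OF _ c]] by blast
        have "(\<Sum>n=M..<M+L. norm (b (Suc n) - b n)) \<le>
           (\<Sum>n=M..<M+L. c * (2 * (1 / real (Suc n) ^ 2) + 1 / (real (Suc n) * (1 + \<bar>real K - real (Suc n)\<bar>))))"
          by (intro sum_mono db)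
        also have "\<dots> = c * (2 * (\<Sum>n=M..<M+L. 1 / real (Suc n) ^ 2)
             + (\<Sum>n=M..<M+L. 1 / (real (Suc n) * (1 + \<bar>real K - real (Suc n)\<bar>))))"
          unfolding sum_distrib_left[symmetric] sum.distrib by simp
        also have "\<dots> \<le> c * (2 * (2 / real (Suc M)) + 3 / sqrt (real (Suc M)))"
          using c by (intro mult_left_mono add_mono sum_inverse_squares_le sum_cross_le) auto
        also have "\<dots> \<le> c * (4 * ?r + 3 * ?r)"
          using c sq[of M] by (intro mult_left_mono) auto
        finally show "(\<Sum>n=M..<M+L. norm (b (Suc n) - b n)) \<le> c * (4 * ?r + 3 * ?r)" .
      qed
      also have "\<dots> = 9 * c / sqrt (real (Suc M))" by simp
      finally have "norm (\<Sum>n=M..<M+L. y ^ n * b n) \<le> 9 * c / sqrt (real (Suc M)) / norm (1 - y)"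
        using cond(1) by (simp add: field_simps)
      then show ?thesis by (simp add: b_def mult.assoc field_simps)
    qed
    have "norm (\<Sum>n=M..<N. y ^ n * d n * F K n) \<le> 9 * c / norm (1 - y) / sqrt (real (Suc M))" for K M N
    proof (cases "M \<le> N")
      case True
      then show ?thesis using bound[where M=M and L="N-M"] by simp
    next
      case False
      then show ?thesis using c by simp
    qed
    then show ?thesis by blast
  qed
qed

lemma inverse_sqrt_tendsto_0: "(\<lambda>N. c / sqrt (real (Suc N))) \<longlonglongrightarrow> 0"
  by real_asymp

lemma summable_if_tail_bound:
  fixes f :: "nat \<Rightarrow> complex"
  assumes "\<And>M N. norm (\<Sum>n=M..<N. f n) \<le> c / sqrt (real (Suc M))"
  shows "summable f" "norm (suminf f - (\<Sum>n<M. f n)) \<le> c / sqrt (real (Suc M))"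
proof -
  show s: "summable f"
    unfolding summable_Cauchy
  proof (intro allI impI)
    fix e :: real assume "e > 0"
    then have "\<forall>\<^sub>F N in sequentially. c / sqrt (real (Suc N)) < e"
      using inverse_sqrt_tendsto_0[of c] by (auto intro: order_tendstoD)
    then obtain N0 where "\<And>N. N \<ge> N0 \<Longrightarrow> c / sqrt (real (Suc N)) < e"
      by (auto simp: eventually_sequentially)
    then show "\<exists>N. \<forall>m\<ge>N. \<forall>n. norm (sum f {m..<n}) < e"
      using assms by (meson le_less_trans)
  qed
  have "(\<lambda>N. norm ((\<Sum>n<N. f n) - (\<Sum>n<M. f n))) \<longlonglongrightarrow> norm (suminf f - (\<Sum>n<M. f n))"
    by (intro tendsto_intros summable_LIMSEQ s)
  moreover have "\<forall>\<^sub>F N in sequentially. norm ((\<Sum>n<N. f n) - (\<Sum>n<M. f n)) \<le> c / sqrt (real (Suc M))"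
    using eventually_ge_at_top[of M]
  proof eventually_elim
    case (elim N)
    have "(\<Sum>n<N. f n) - (\<Sum>n<M. f n) = (\<Sum>n=M..<N. f n)"
      using sum_diff_nat_ivl[of 0 M N f] elim by (simp add: atLeast0LessThan)
    then show ?case using assms by simp
  qed
  ultimately show "norm (suminf f - (\<Sum>n<M. f n)) \<le> c / sqrt (real (Suc M))"
    by (rule tendsto_upperbound) simp
qed

text \<open>A Moore-Osgood exchange: the tails are small uniformly in \<open>K\<close>, and the same
  tail bound passes to \<open>G\<close> as a pointwise limit of finite sums.\<close>

lemma slowly_varying_limit:
  assumes "dirichlet_weight y d" "slowly_varying F" and lim: "\<And>n. (\<lambda>K. F K n) \<longlonglongrightarrow> G n"
  shows "summable (\<lambda>n. y ^ n * d n * F K n)" "summable (\<lambda>n. y ^ n * d n * G n)"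
    "(\<lambda>K. \<Sum>n. y ^ n * d n * F K n) \<longlonglongrightarrow> (\<Sum>n. y ^ n * d n * G n)"
proof -
  obtain c where c: "\<And>K M N. norm (\<Sum>n=M..<N. y ^ n * d n * F K n) \<le> c / sqrt (real (Suc M))"
    using slowly_varying_tail_bound[OF assms(1,2)] by blast
  note F = summable_if_tail_bound[OF c]
  have part: "(\<lambda>K. \<Sum>n\<in>A. y ^ n * d n * F K n) \<longlonglongrightarrow> (\<Sum>n\<in>A. y ^ n * d n * G n)" for A
    by (intro tendsto_intros lim)
  have "norm (\<Sum>n=M..<N. y ^ n * d n * G n) \<le> c / sqrt (real (Suc M))" for M N
    by (rule tendsto_upperbound[OF tendsto_norm[OF part]]) (use c in auto)
  note G = summable_if_tail_bound[OF this]
  show "summable (\<lambda>n. y ^ n * d n * F K n)" by (rule F)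
  show "summable (\<lambda>n. y ^ n * d n * G n)" by (rule G)
  show "(\<lambda>K. \<Sum>n. y ^ n * d n * F K n) \<longlonglongrightarrow> (\<Sum>n. y ^ n * d n * G n)"
  proof (rule swap_uniform_limit'[where S = UNIV and F = sequentially])
    show "\<forall>\<^sub>F N in sequentially. ((\<lambda>K. \<Sum>n<N. y ^ n * d n * F K n) \<longlongrightarrow> (\<Sum>n<N. y ^ n * d n * G n)) sequentially"
      using part by simp
    show "(\<lambda>N. \<Sum>n<N. y ^ n * d n * G n) \<longlonglongrightarrow> (\<Sum>n. y ^ n * d n * G n)"
      by (rule summable_LIMSEQ[OF G(1)])
    show "uniform_limit UNIV (\<lambda>N K. \<Sum>n<N. y ^ n * d n * F K n) (\<lambda>K. \<Sum>n. y ^ n * d n * F K n) sequentially"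
    proof (rule uniform_limitI)
      fix e :: real assume "e > 0"
      then have "\<forall>\<^sub>F N in sequentially. c / sqrt (real (Suc N)) < e"
        using inverse_sqrt_tendsto_0[of c] by (auto intro: order_tendstoD)
      then show "\<forall>\<^sub>F N in sequentially. \<forall>K\<in>UNIV. dist (\<Sum>n<N. y ^ n * d n * F K n) (\<Sum>n. y ^ n * d n * F K n) < e"
      proof eventually_elim
        case (elim N)
        then show ?case using F(2) by (auto simp: dist_norm norm_minus_commute intro: le_less_trans)
      qed
    qed
  qed auto
qed

text \<open>Product rule for differences; each of its two terms contributes one
  \<open>c1 * c2\<close>, whence the constant \<open>2 * c1 * c2\<close>.\<close>

lemma slowly_varying_mult:
  assumes "slowly_varying F" "slowly_varying G" shows "slowly_varying (\<lambda>K n. F K n * G K n)"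
proof -
  from assms obtain c1 c2 where
    F: "\<And>K n. norm (F K n) \<le> c1" "\<And>K n. norm (F K (Suc n) - F K n) \<le> c1 / real (Suc n) + c1 / (1 + \<bar>real K - real (Suc n)\<bar>)"
    and G: "\<And>K n. norm (G K n) \<le> c2" "\<And>K n. norm (G K (Suc n) - G K n) \<le> c2 / real (Suc n) + c2 / (1 + \<bar>real K - real (Suc n)\<bar>)"
    unfolding slowly_varying_def by metis
  have c: "c1 \<ge> 0" "c2 \<ge> 0" using F(1)[of 0 0] G(1)[of 0 0] norm_ge_zero order_trans by blast+
  have "norm (F K n * G K n) \<le> 2 * c1 * c2 \<and> norm (F K (Suc n) * G K (Suc n) - F K n * G K n)
      \<le> (2 * c1 * c2) / real (Suc n) + (2 * c1 * c2) / (1 + \<bar>real K - real (Suc n)\<bar>)" for K n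
  proof
    have "norm (F K n * G K n) \<le> c1 * c2" unfolding norm_mult by (intro mult_mono F G) (use c in auto)
    moreover have "0 \<le> c1 * c2" using c by simp
    ultimately show "norm (F K n * G K n) \<le> 2 * c1 * c2" by linarith
    have "F K (Suc n) * G K (Suc n) - F K n * G K n = F K (Suc n) * (G K (Suc n) - G K n) + (F K (Suc n) - F K n) * G K n"
      by (simp add: algebra_simps)
    then have "norm (F K (Suc n) * G K (Suc n) - F K n * G K n) \<le> norm (F K (Suc n)) * norm (G K (Suc n) - G K n) + norm (F K (Suc n) - F K n) * norm (G K n)"
      by (metis norm_triangle_ineq norm_mult)
    also have "\<dots> \<le> c1 * (c2 / real (Suc n) + c2 / (1 + \<bar>real K - real (Suc n)\<bar>)) + (c1 / real (Suc n) + c1 / (1 + \<bar>real K - real (Suc n)\<bar>)) * c2"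
      by (intro add_mono mult_mono F G) (use c in auto)
    also have "\<dots> = (2 * c1 * c2) / real (Suc n) + (2 * c1 * c2) / (1 + \<bar>real K - real (Suc n)\<bar>)"
      by (simp add: ring_distribs mult_ac del: of_nat_Suc)
    finally show "norm (F K (Suc n) * G K (Suc n) - F K n * G K n)
      \<le> (2 * c1 * c2) / real (Suc n) + (2 * c1 * c2) / (1 + \<bar>real K - real (Suc n)\<bar>)" .
  qed
  then show ?thesis unfolding slowly_varying_def by blast
qed

section \<open>Partial fractions\<close>

text \<open>With \<open>D = 1 / (v - u)\<close> and \<open>Z i = u\<^bsup>-i\<^esup>\<close> this is the principal part at \<open>u = 0\<close> of \<open>u\<^bsup>-m\<^esup> v\<^bsup>-n\<^esup>\<close>, where
  \<open>v - u\<close> is constant. Keeping \<open>Z\<close> abstract lets one lemma serve both for values at a point and for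
  Taylor coefficients.\<close>

definition pole_part :: "nat \<Rightarrow> nat \<Rightarrow> complex \<Rightarrow> (nat \<Rightarrow> complex) \<Rightarrow> complex" where
  "pole_part m n D Z = (\<Sum>i<m. of_nat ((n + i - 1) choose i) * (-1) ^ i * D ^ (n + i) * Z (m - i))"

lemma pole_part_0_left [simp]: "pole_part 0 n D Z = 0"
  by (simp add: pole_part_def)

text \<open>For \<open>n = 0\<close> the truncated subtraction in the binomial leaves 1 at
  \<open>i = 0\<close> and 0 afterwards, so a lone power is its own principal part.\<close>

lemma pole_part_0_right: "m > 0 \<Longrightarrow> pole_part m 0 D Z = Z m"
proof -
  assume "m > 0"
  then obtain k where m: "m = Suc k" by (cases m) auto
  have "pole_part m 0 D Z = Z m + (\<Sum>i<k. of_nat ((i choose Suc i)) * (-1) ^ Suc i * D ^ Suc i * Z (m - Suc i))"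
    unfolding pole_part_def m sum.lessThan_Suc_shift by simp
  also have "(\<Sum>i<k. of_nat ((i choose Suc i)) * (-1) ^ Suc i * D ^ Suc i * Z (m - Suc i)) = 0"
    by (intro sum.neutral) (simp add: binomial_eq_0)
  finally show ?thesis by simp
qed

text \<open>Principal parts obey the recursion coming from 1 / (u v) = (1/u - 1/v) / (v - u);
  comparing coefficients, this is Pascal's rule.\<close>

lemma pole_part_Suc_Suc: "pole_part (Suc m) (Suc n) D Z = D * (pole_part (Suc m) n D Z - pole_part m (Suc n) D Z)"
proof -
  define A B :: "nat \<Rightarrow> complex"
    where "A i = of_nat ((n + i) choose Suc i)" and "B i = of_nat ((n + i) choose i)" for i
  have pascal: "of_nat (Suc (n + i) choose Suc i) = A i + B i" for i
    by (simp add: A_def B_def)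
  have "pole_part (Suc m) n D Z - pole_part m (Suc n) D Z = D ^ n * Z (Suc m) +
     (\<Sum>i<m. A i * (-1) ^ Suc i * D ^ (n + Suc i) * Z (m - i) - B i * (-1) ^ i * D ^ (n + Suc i) * Z (m - i))"
    unfolding pole_part_def sum.lessThan_Suc_shift sum_subtractf A_def B_def by simp
  moreover have "D * (A i * (-1) ^ Suc i * D ^ (n + Suc i) * Z (m - i) - B i * (-1) ^ i * D ^ (n + Suc i) * Z (m - i))
      = (A i + B i) * (-1) ^ Suc i * D ^ (Suc n + Suc i) * Z (m - i)" for i
    by (simp add: algebra_simps)
  ultimately have "D * (pole_part (Suc m) n D Z - pole_part m (Suc n) D Z) = D ^ Suc n * Z (Suc m) +
     (\<Sum>i<m. (A i + B i) * (-1) ^ Suc i * D ^ (Suc n + Suc i) * Z (m - i))"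
    by (simp only: distrib_left sum_distrib_left) simp
  also have "\<dots> = pole_part (Suc m) (Suc n) D Z"
    unfolding pole_part_def sum.lessThan_Suc_shift pascal[symmetric] by simp
  finally show ?thesis by simp
qed

text \<open>Both sides satisfy the same recursion and agree when \<open>m\<close> or
  \<open>n\<close> is 0. Exchanging the two factors negates \<open>D\<close>. For
  \<open>m = n = 0\<close> both principal parts are empty while \<open>Z 0 0\<close> need not
  vanish.\<close>

lemma partial_fraction:
  assumes step: "\<And>m n. Z (Suc m) (Suc n) = D * (Z (Suc m) n - Z m (Suc n))"
    and "m + n > 0"
  shows "Z m n = pole_part m n D (\<lambda>i. Z i 0) + pole_part n m (-D) (\<lambda>i. Z 0 i)"
  using assms(2)
proof (induction "m + n" arbitrary: m n)
  case 0
  then show ?case by simp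
next
  case (Suc s)
  show ?case
  proof (cases m; cases n)
    fix m' n' assume m: "m = Suc m'" and n: "n = Suc n'"
    have "Z m n = D * (Z (Suc m') n' - Z m' (Suc n'))" unfolding m n by (rule step)
    also have "Z (Suc m') n' = pole_part (Suc m') n' D (\<lambda>i. Z i 0) + pole_part n' (Suc m') (-D) (\<lambda>i. Z 0 i)"
      by (rule Suc.hyps) (use Suc.hyps(2) m n in auto)
    also have "Z m' (Suc n') = pole_part m' (Suc n') D (\<lambda>i. Z i 0) + pole_part (Suc n') m' (-D) (\<lambda>i. Z 0 i)"
      by (rule Suc.hyps) (use Suc.hyps(2) m n in auto)
    finally show ?thesis unfolding m n pole_part_Suc_Suc by (simp add: algebra_simps)
  qed (use Suc.prems in \<open>auto simp: pole_part_0_right\<close>)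
qed

lemma pole_part_sums:
  assumes "\<And>i. i \<ge> 1 \<Longrightarrow> (\<lambda>n. Z n i) sums L i"
  shows "(\<lambda>n. pole_part m r D (Z n)) sums pole_part m r D L"
  unfolding pole_part_def by (intro sums_sum sums_mult assms) auto

lemma pole_part_cmult: "pole_part m n D (\<lambda>i. c * Z i) = c * pole_part m n D Z"
  by (simp add: pole_part_def sum_distrib_left mult_ac)

lemma pole_part_diff: "pole_part m n D (\<lambda>i. Z i - Z' i) = pole_part m n D Z - pole_part m n D Z'"
  by (simp add: pole_part_def sum_subtractf algebra_simps)

lemma pole_part_sum: "pole_part m n D (\<lambda>i. \<Sum>j\<in>A. Z j i) = (\<Sum>j\<in>A. pole_part m n D (Z j))"
  unfolding pole_part_def sum_distrib_left by (rule sum.swap)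

text \<open>\<open>Z k i\<close> stands for the \<open>i\<close>-th power of
  \<open>1 / (s + a + k)\<close>. Only the principal parts at the poles of the first factor are
  collected; those of the second factor come from the same formula with the factors
  exchanged.\<close>

definition cross_poles :: "complex \<Rightarrow> nat \<Rightarrow> complex \<Rightarrow> nat \<Rightarrow> nat \<Rightarrow> (nat \<Rightarrow> nat \<Rightarrow> complex) \<Rightarrow> complex" where
  "cross_poles x1 p1 x2 p2 K Z =
     (\<Sum>k\<le>K. x1 ^ k * (\<Sum>l\<in>{..K}-{k}. x2 ^ l * pole_part p1 p2 (1 / (of_nat l - of_nat k)) (Z k)))"

text \<open>Equal indices in the two factors merge into one pole of order \<open>p1 + p2\<close>,
  hence the separate first sum. The expression is linear in \<open>Z\<close>, so it commutes with
  sums over the integers and with extracting coefficients.\<close>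

definition product_poles :: "complex \<Rightarrow> nat \<Rightarrow> complex \<Rightarrow> nat \<Rightarrow> nat \<Rightarrow> (nat \<Rightarrow> nat \<Rightarrow> complex) \<Rightarrow> complex" where
  "product_poles x1 p1 x2 p2 K Z = (\<Sum>k\<le>K. (x1 * x2) ^ k * Z k (p1 + p2))
     + cross_poles x1 p1 x2 p2 K Z + cross_poles x2 p2 x1 p1 K Z"

lemma cross_poles_sums:
  assumes "\<And>k i. i \<ge> 1 \<Longrightarrow> (\<lambda>n. Z n k i) sums L k i"
  shows "(\<lambda>n. cross_poles x1 p1 x2 p2 K (Z n)) sums cross_poles x1 p1 x2 p2 K L"
  unfolding cross_poles_def by (intro sums_sum sums_mult pole_part_sums assms)

lemma product_poles_sums:
  assumes "\<And>k i. i \<ge> 1 \<Longrightarrow> (\<lambda>n. Z n k i) sums L k i" and "p1 + p2 \<ge> 1"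
  shows "(\<lambda>n. product_poles x1 p1 x2 p2 K (Z n)) sums product_poles x1 p1 x2 p2 K L"
  unfolding product_poles_def by (intro sums_add sums_sum sums_mult cross_poles_sums assms)

lemma product_poles_cmult: "product_poles x1 p1 x2 p2 K (\<lambda>k i. c * Z k i) = c * product_poles x1 p1 x2 p2 K Z"
  by (simp add: product_poles_def cross_poles_def pole_part_cmult sum_distrib_left algebra_simps)

lemma product_poles_diff: "product_poles x1 p1 x2 p2 K (\<lambda>k i. Z k i - Z' k i) = product_poles x1 p1 x2 p2 K Z - product_poles x1 p1 x2 p2 K Z'"
  by (simp add: product_poles_def cross_poles_def pole_part_diff sum_subtractf algebra_simps)

lemma cross_poles_sum: "cross_poles x1 p1 x2 p2 K (\<lambda>k i. \<Sum>j\<in>A. Z j k i) = (\<Sum>j\<in>A. cross_poles x1 p1 x2 p2 K (Z j))"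
proof -
  have "(\<Sum>j\<in>A. cross_poles x1 p1 x2 p2 K (Z j)) =
    (\<Sum>k\<le>K. \<Sum>j\<in>A. x1 ^ k * (\<Sum>l\<in>{..K}-{k}. x2 ^ l * pole_part p1 p2 (1 / (of_nat l - of_nat k)) (Z j k)))"
    unfolding cross_poles_def by (rule sum.swap)
  also have "\<dots> = (\<Sum>k\<le>K. x1 ^ k * (\<Sum>l\<in>{..K}-{k}. \<Sum>j\<in>A. x2 ^ l * pole_part p1 p2 (1 / (of_nat l - of_nat k)) (Z j k)))"
    unfolding sum_distrib_left by (rule sum.cong[OF refl], rule sum.swap)
  finally show ?thesis by (simp add: cross_poles_def pole_part_sum sum_distrib_left)
qed

lemma product_poles_sum: "product_poles x1 p1 x2 p2 K (\<lambda>k i. \<Sum>j\<in>A. Z j k i) = (\<Sum>j\<in>A. product_poles x1 p1 x2 p2 K (Z j))"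
proof -
  have "(\<Sum>k\<le>K. (x1 * x2) ^ k * (\<Sum>j\<in>A. Z j k (p1 + p2))) = (\<Sum>j\<in>A. \<Sum>k\<le>K. (x1 * x2) ^ k * Z j k (p1 + p2))"
    unfolding sum_distrib_left by (rule sum.swap)
  then show ?thesis by (simp add: product_poles_def cross_poles_sum sum.distrib)
qed

text \<open>\<open>Z k m l n\<close> abstracts the product of the \<open>m\<close>-th power of
  \<open>1 / (s + a + k)\<close> and the \<open>n\<close>-th power of
  \<open>1 / (s + a + l)\<close>, as a number or as a Taylor coefficient. Off the diagonal it splits
  into partial fractions; on the diagonal it already is a single power.\<close>

lemma product_eq_product_poles:
  fixes Z :: "nat \<Rightarrow> nat \<Rightarrow> nat \<Rightarrow> nat \<Rightarrow> complex"
  assumes step: "\<And>k l m n. k \<noteq> l \<Longrightarrow>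
      Z k (Suc m) l (Suc n) = 1 / (of_nat l - of_nat k) * (Z k (Suc m) l n - Z k m l (Suc n))"
    and "\<And>k l m. Z k m l 0 = Z' k m" "\<And>k l n. Z k 0 l n = Z' l n"
      "\<And>k m n. Z k m k n = Z' k (m + n)"
    and p: "p1 + p2 > 0"
  shows "(\<Sum>k\<le>K. \<Sum>l\<le>K. x1 ^ k * x2 ^ l * Z k p1 l p2) = product_poles x1 p1 x2 p2 K Z'"
proof -
  have pfz: "Z k p1 l p2 = pole_part p1 p2 (1 / (of_nat l - of_nat k)) (Z' k) + pole_part p2 p1 (1 / (of_nat k - of_nat l)) (Z' l)"
    if "k \<noteq> l" for k l
  proof -
    have "- (1 / (of_nat l - of_nat k)) = (1 / (of_nat k - of_nat l) :: complex)"
      by (metis minus_diff_eq minus_divide_right)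
    then show ?thesis
      using partial_fraction[of "\<lambda>m n. Z k m l n", OF step[OF that] p] assms(2,3) by simp
  qed
  have "(\<Sum>l\<le>K. x1 ^ k * x2 ^ l * Z k p1 l p2) = (x1 * x2) ^ k * Z' k (p1 + p2) +
      (\<Sum>l\<in>{..K}-{k}. x1 ^ k * x2 ^ l * (pole_part p1 p2 (1 / (of_nat l - of_nat k)) (Z' k) + pole_part p2 p1 (1 / (of_nat k - of_nat l)) (Z' l)))"
    if "k \<le> K" for k
  proof -
    have "(\<Sum>l\<le>K. x1 ^ k * x2 ^ l * Z k p1 l p2) =
      x1 ^ k * x2 ^ k * Z k p1 k p2 + (\<Sum>l\<in>{..K}-{k}. x1 ^ k * x2 ^ l * Z k p1 l p2)"
      using that by (intro sum.remove) auto
    also have "(\<Sum>l\<in>{..K}-{k}. x1 ^ k * x2 ^ l * Z k p1 l p2) =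
      (\<Sum>l\<in>{..K}-{k}. x1 ^ k * x2 ^ l * (pole_part p1 p2 (1 / (of_nat l - of_nat k)) (Z' k) + pole_part p2 p1 (1 / (of_nat k - of_nat l)) (Z' l)))"
      by (intro sum.cong refl) (auto simp: pfz)
    finally show ?thesis by (simp add: assms(4) power_mult_distrib)
  qed
  then have "(\<Sum>k\<le>K. \<Sum>l\<le>K. x1 ^ k * x2 ^ l * Z k p1 l p2) =
     (\<Sum>k\<le>K. (x1 * x2) ^ k * Z' k (p1 + p2))
     + (\<Sum>k\<le>K. \<Sum>l\<in>{..K}-{k}. x1 ^ k * x2 ^ l * pole_part p1 p2 (1 / (of_nat l - of_nat k)) (Z' k))
     + (\<Sum>k\<le>K. \<Sum>l\<in>{..K}-{k}. x1 ^ k * x2 ^ l * pole_part p2 p1 (1 / (of_nat k - of_nat l)) (Z' l))"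
    by (simp add: sum.distrib distrib_left)
  also have "(\<Sum>k\<le>K. \<Sum>l\<in>{..K}-{k}. x1 ^ k * x2 ^ l * pole_part p1 p2 (1 / (of_nat l - of_nat k)) (Z' k)) =
      cross_poles x1 p1 x2 p2 K Z'"
    by (simp add: cross_poles_def sum_distrib_left mult.assoc)
  \<comment> \<open>Writing the deleted diagonal as a symmetric condition allows the order of
    summation to be exchanged, so that the pole index becomes the outer one.\<close>
  also have "(\<Sum>k\<le>K. \<Sum>l\<in>{..K}-{k}. x1 ^ k * x2 ^ l * pole_part p2 p1 (1 / (of_nat k - of_nat l)) (Z' l)) =
      (\<Sum>k\<le>K. \<Sum>l\<in>{l \<in> {..K}. k \<noteq> l}. x1 ^ k * x2 ^ l * pole_part p2 p1 (1 / (of_nat k - of_nat l)) (Z' l))"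
    by (intro sum.cong) auto
  also have "\<dots> = (\<Sum>l\<le>K. \<Sum>k\<in>{k \<in> {..K}. k \<noteq> l}. x1 ^ k * x2 ^ l * pole_part p2 p1 (1 / (of_nat k - of_nat l)) (Z' l))"
    by (rule sum.swap_restrict) auto
  also have "\<dots> = (\<Sum>l\<le>K. \<Sum>k\<in>{..K}-{l}. x1 ^ k * x2 ^ l * pole_part p2 p1 (1 / (of_nat k - of_nat l)) (Z' l))"
    by (intro sum.cong) auto
  also have "\<dots> = cross_poles x2 p2 x1 p1 K Z'"
    by (simp add: cross_poles_def sum_distrib_left mult_ac)
  finally show ?thesis by (simp add: product_poles_def)
qed

section \<open>Taylor coefficients at 0 through formal power series\<close>

definition recip_fps :: "complex \<Rightarrow> complex fps" where
  "recip_fps \<alpha> = inverse (fps_X + fps_const \<alpha>)"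

text \<open>The binomial series with exponent \<open>-m\<close>. At \<open>m = 0\<close> the
  truncated subtraction gives 1 for \<open>j = 0\<close> and 0 beyond, as it should.\<close>

lemma recip_fps_nth:
  assumes "\<alpha> \<noteq> 0"
  shows "fps_nth (recip_fps \<alpha> ^ m) j = of_nat ((m + j - 1) choose j) * (-1) ^ j * (1 / \<alpha>) ^ (m + j)"
proof (cases "m = 0")
  case True
  then show ?thesis by (cases j) (auto simp: binomial_eq_0)
next
  case False
  have "fps_X + fps_const \<alpha> = fps_const \<alpha> * (1 - fps_const (- 1 / \<alpha>) * fps_X)"
    using assms by (simp add: right_diff_distrib flip: mult.assoc)
  then have "recip_fps \<alpha> = fps_const (1 / \<alpha>) * inverse (1 - fps_const (- 1 / \<alpha>) * fps_X)"
    by (simp only: recip_fps_def fps_inverse_mult fps_const_inverse inverse_eq_divide)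
  then have "recip_fps \<alpha> ^ m = fps_const ((1 / \<alpha>) ^ m) * inverse ((1 - fps_const (- 1 / \<alpha>) * fps_X) ^ m)"
    by (simp only: power_mult_distrib fps_const_power fps_inverse_power)
  also have "inverse ((1 - fps_const (- 1 / \<alpha>) * fps_X) ^ m) = Abs_fps (\<lambda>k. of_nat ((m + k - 1) choose k) * (- 1 / \<alpha>) ^ k)"
    using False by (intro one_minus_const_fps_X_neg_power') simp
  finally have "fps_nth (recip_fps \<alpha> ^ m) j = (1 / \<alpha>) ^ m * (of_nat ((m + j - 1) choose j) * (- 1 / \<alpha>) ^ j)"
    by simp
  also have "(- 1 / \<alpha>) ^ j = (-1) ^ j * (1 / \<alpha>) ^ j"
    by (simp flip: power_mult_distrib)
  finally show ?thesis by (simp add: power_add)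
qed

lemma recip_fps_mult:
  assumes "\<alpha> \<noteq> 0" "\<beta> \<noteq> 0" "\<alpha> \<noteq> \<beta>"
  shows "recip_fps \<alpha> * recip_fps \<beta> = fps_const (1 / (\<beta> - \<alpha>)) * (recip_fps \<alpha> - recip_fps \<beta>)"
proof -
  have 1: "recip_fps \<alpha> * (fps_X + fps_const \<alpha>) = 1" "recip_fps \<beta> * (fps_X + fps_const \<beta>) = 1"
    unfolding recip_fps_def using assms by (simp_all add: inverse_mult_eq_1)
  have "recip_fps \<alpha> - recip_fps \<beta> = recip_fps \<alpha> * (recip_fps \<beta> * (fps_X + fps_const \<beta>))
      - recip_fps \<beta> * (recip_fps \<alpha> * (fps_X + fps_const \<alpha>))"
    by (simp add: 1)
  also have "\<dots> = fps_const (\<beta> - \<alpha>) * (recip_fps \<alpha> * recip_fps \<beta>)"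
    by (simp add: algebra_simps flip: fps_const_sub)
  finally show ?thesis using assms by (simp flip: mult.assoc)
qed

lemma product_poles_complex:
  fixes s a :: complex
  assumes "\<And>k. s + a + of_nat k \<noteq> 0" "p1 + p2 > 0"
  shows "(\<Sum>k\<le>K. x1 ^ k / (s + a + of_nat k) ^ p1) * (\<Sum>l\<le>K. x2 ^ l / (s + a + of_nat l) ^ p2) =
    product_poles x1 p1 x2 p2 K (\<lambda>k i. 1 / (s + a + of_nat k) ^ i)"
proof -
  let ?U = "\<lambda>k. 1 / (s + a + of_nat k)"
  have U: "?U k * ?U l = 1 / (of_nat l - of_nat k) * (?U k - ?U l)" if "k \<noteq> l" for k l :: nat
  proof -
    have "of_nat l - of_nat k \<noteq> (0::complex)" using that by simp
    then show ?thesis using assms(1)[of k] assms(1)[of l] by (simp add: field_simps)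
  qed
  have "(\<Sum>k\<le>K. x1 ^ k / (s + a + of_nat k) ^ p1) * (\<Sum>l\<le>K. x2 ^ l / (s + a + of_nat l) ^ p2) =
    (\<Sum>k\<le>K. \<Sum>l\<le>K. x1 ^ k * x2 ^ l * (?U k ^ p1 * ?U l ^ p2))"
    unfolding sum_product by (simp add: power_divide)
  also have "\<dots> = product_poles x1 p1 x2 p2 K (\<lambda>k i. ?U k ^ i)"
  proof (rule product_eq_product_poles)
    fix k l m n :: nat assume "k \<noteq> l"
    have "?U k ^ Suc m * ?U l ^ Suc n = (?U k ^ m * ?U l ^ n) * (?U k * ?U l)" by simp
    also have "\<dots> = 1 / (of_nat l - of_nat k) * (?U k ^ Suc m * ?U l ^ n - ?U k ^ m * ?U l ^ Suc n)"
      unfolding U[OF \<open>k \<noteq> l\<close>] by (simp only: power_Suc right_diff_distrib mult_ac)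
    finally show "?U k ^ Suc m * ?U l ^ Suc n = 1 / (of_nat l - of_nat k) * (?U k ^ Suc m * ?U l ^ n - ?U k ^ m * ?U l ^ Suc n)" .
  qed (use assms(2) in \<open>simp_all add: power_add\<close>)
  finally show ?thesis by (simp add: power_divide)
qed

text \<open>The \<open>j\<close>-th Taylor coefficient at 0 of the product of the two truncated
  series, computed once by partial fractions and once as a Cauchy product.\<close>

lemma product_poles_fps:
  fixes a :: complex
  assumes "\<And>k. a + of_nat k \<noteq> 0" "p1 + p2 > 0"
  shows "product_poles x1 p1 x2 p2 K (\<lambda>k i. fps_nth (recip_fps (a + of_nat k) ^ i) j) =
    (\<Sum>i\<le>j. (\<Sum>k\<le>K. x1 ^ k * fps_nth (recip_fps (a + of_nat k) ^ p1) i) *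
       (\<Sum>l\<le>K. x2 ^ l * fps_nth (recip_fps (a + of_nat l) ^ p2) (j - i)))"
proof -
  let ?U = "\<lambda>k. recip_fps (a + of_nat k)"
  have U: "?U k * ?U l = fps_const (1 / (of_nat l - of_nat k)) * (?U k - ?U l)" if "k \<noteq> l" for k l :: nat
    using recip_fps_mult[of "a + of_nat k" "a + of_nat l"] assms(1) that by simp
  have "product_poles x1 p1 x2 p2 K (\<lambda>k i. fps_nth (?U k ^ i) j) =
    (\<Sum>k\<le>K. \<Sum>l\<le>K. x1 ^ k * x2 ^ l * fps_nth (?U k ^ p1 * ?U l ^ p2) j)"
  proof (rule product_eq_product_poles[symmetric])
    fix k l m n :: nat assume "k \<noteq> l"
    have "?U k ^ Suc m * ?U l ^ Suc n = (?U k ^ m * ?U l ^ n) * (?U k * ?U l)" by simp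
    also have "\<dots> = fps_const (1 / (of_nat l - of_nat k)) * (?U k ^ Suc m * ?U l ^ n - ?U k ^ m * ?U l ^ Suc n)"
      unfolding U[OF \<open>k \<noteq> l\<close>] by (simp only: power_Suc right_diff_distrib mult_ac)
    finally show "fps_nth (?U k ^ Suc m * ?U l ^ Suc n) j =
        1 / (of_nat l - of_nat k) * (fps_nth (?U k ^ Suc m * ?U l ^ n) j - fps_nth (?U k ^ m * ?U l ^ Suc n) j)"
      by (simp only: fps_mult_left_const_nth fps_sub_nth)
  qed (use assms(2) in \<open>simp_all add: power_add\<close>)
  also have "\<dots> = fps_nth ((\<Sum>k\<le>K. fps_const (x1 ^ k) * ?U k ^ p1) * (\<Sum>l\<le>K. fps_const (x2 ^ l) * ?U l ^ p2)) j"
  proof -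
    have "(fps_const (x1 ^ k) * ?U k ^ p1) * (fps_const (x2 ^ l) * ?U l ^ p2) =
       fps_const (x1 ^ k * x2 ^ l) * (?U k ^ p1 * ?U l ^ p2)" for k l
      by (simp add: mult_ac flip: fps_const_mult)
    then show ?thesis unfolding sum_product by (simp only: fps_sum_nth fps_mult_left_const_nth)
  qed
  also have "\<dots> = (\<Sum>i\<le>j. (\<Sum>k\<le>K. x1 ^ k * fps_nth (?U k ^ p1) i) * (\<Sum>l\<le>K. x2 ^ l * fps_nth (?U l ^ p2) (j - i)))"
    unfolding fps_mult_nth by (simp add: fps_sum_nth atLeast0AtMost)
  finally show ?thesis .
qed

section \<open>Truncated Lerch series at the integers\<close>

definition shift_bounded_below :: "complex \<Rightarrow> bool" where
  "shift_bounded_below b \<longleftrightarrow> (\<exists>c>0. \<forall>n. c * real (Suc n) \<le> norm (of_nat n + b))"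

lemma shift_bounded_belowI:
  assumes "\<And>n. of_nat n + b \<noteq> 0"
  shows "shift_bounded_below b"
proof -
  \<comment> \<open>Beyond \<open>N\<close> the triangle inequality gives a lower bound of (n + 1) /
    2; only finitely many values remain, and they have a positive minimum.\<close>
  define N where "N = nat \<lceil>2 * norm b + 1\<rceil>"
  define c0 where "c0 = Min ((\<lambda>n. norm (of_nat n + b)) ` {..N})"
  have c0: "c0 > 0" "\<And>n. n \<le> N \<Longrightarrow> c0 \<le> norm (of_nat n + b)"
    using assms by (auto simp: c0_def)
  define c where "c = min (1 / 2) (c0 / real (Suc N))"
  have "c * real (Suc n) \<le> norm (of_nat n + b)" for n
  proof (cases "n \<le> N")
    case True
    have "c \<le> c0 / real (Suc N)" unfolding c_def by (rule min.cobounded2)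
    then have "c * real (Suc n) \<le> c0 / real (Suc N) * real (Suc N)"
      using True c0(1) by (intro mult_mono) auto
    then show ?thesis using c0(2)[OF True] by simp
  next
    case False
    then have "real n \<ge> 2 * norm b + 1"
      unfolding N_def by linarith
    moreover have "real n \<le> norm (of_nat n + b) + norm b"
      using norm_triangle_ineq4[of "of_nat n + b" b] by simp
    moreover have "c \<le> 1 / 2" unfolding c_def by (rule min.cobounded1)
    then have "c * real (Suc n) \<le> 1 / 2 * real (Suc n)"
      by (rule mult_right_mono) simp
    moreover have "1 / 2 * real (Suc n) = real n / 2 + 1 / 2" by simp
    ultimately show ?thesis by argo
  qed
  moreover have "c > 0" using c0(1) by (simp add: c_def)
  ultimately show ?thesis unfolding shift_bounded_below_def by blast
qed

text \<open>For \<open>t = 1\<close> the difference of consecutive reciprocals is minus their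
  product, hence of second order.\<close>

lemma dirichlet_weight_reciprocal_power:
  assumes "shift_bounded_below b" "norm y = 1" "t \<ge> 1" "(t, y) \<noteq> (1, 1)"
  shows "dirichlet_weight y (\<lambda>n. 1 / (of_nat n + b) ^ t)"
proof -
  obtain c where c: "c > 0" "\<And>n. c * real (Suc n) \<le> norm (of_nat n + b)"
    using assms(1) unfolding shift_bounded_below_def by blast
  have nz: "of_nat m + b \<noteq> 0" for m
    using c(1) c(2)[of m] by (metis norm_zero not_less mult_pos_pos of_nat_0_less_iff zero_less_Suc)
  have bound: "norm (1 / (of_nat n + b) ^ s) \<le> 1 / c ^ s * (1 / real (Suc n) ^ s)" for n s
  proof -
    have "norm (1 / (of_nat n + b) ^ s) = 1 / norm (of_nat n + b) ^ s"
      by (simp add: norm_divide norm_power)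
    also have "\<dots> \<le> 1 / (c * real (Suc n)) ^ s"
      using c nz by (intro divide_left_mono power_mono mult_pos_pos zero_less_power) auto
    finally show ?thesis by (simp add: power_mult_distrib)
  qed
  show ?thesis
  proof (cases "t \<ge> 2")
    case True
    have "norm (1 / (of_nat n + b) ^ t) \<le> 1 / c ^ t / real (Suc n) ^ 2" for n
    proof -
      have "1 / c ^ t * (1 / real (Suc n) ^ t) \<le> 1 / c ^ t * (1 / real (Suc n) ^ 2)"
        using c(1) True by (intro mult_left_mono divide_left_mono power_increasing) auto
      then show ?thesis using bound[of n t] by simp
    qed
    then show ?thesis unfolding dirichlet_weight_def using assms(2) by blast
  next
    case False
    then have t: "t = 1" "y \<noteq> 1" using assms by auto
    define C where "C = 1 / c + 1 / c ^ 2"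
    have C: "1 / c \<le> C" "1 / c ^ 2 \<le> C" "0 \<le> C" using c(1) by (auto simp: C_def)
    have "norm (1 / (of_nat n + b)) \<le> C / real (Suc n)" for n
    proof -
      have "norm (1 / (of_nat n + b)) \<le> 1 / c * (1 / real (Suc n))" using bound[of n 1] by simp
      also have "\<dots> \<le> C * (1 / real (Suc n))" by (intro mult_right_mono C) auto
      finally show ?thesis by simp
    qed
    moreover have "norm (1 / (of_nat (Suc n) + b) - 1 / (of_nat n + b)) \<le> C / real (Suc n) ^ 2" for n
    proof -
      have "1 / (of_nat (Suc n) + b) - 1 / (of_nat n + b) = - (1 / (of_nat n + b) * (1 / (of_nat (Suc n) + b)))"
        using nz[of n] nz[of "Suc n"] by (simp add: divide_simps)
      then have "norm (1 / (of_nat (Suc n) + b) - 1 / (of_nat n + b)) = norm (1 / (of_nat n + b)) * norm (1 / (of_nat (Suc n) + b))"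
        by (simp only: norm_minus_cancel norm_mult)
      also have "\<dots> \<le> (1 / c * (1 / real (Suc n))) * (1 / c * (1 / real (Suc n)))"
      proof (rule mult_mono)
        have "norm (1 / (of_nat (Suc n) + b)) \<le> 1 / c * (1 / real (Suc (Suc n)))" using bound[of "Suc n" 1] by simp
        also have "\<dots> \<le> 1 / c * (1 / real (Suc n))" using c(1) by (intro mult_left_mono divide_left_mono) auto
        finally show "norm (1 / (of_nat (Suc n) + b)) \<le> 1 / c * (1 / real (Suc n))" .
      qed (use bound[of n 1] c(1) in auto)
      also have "\<dots> = 1 / c ^ 2 * (1 / real (Suc n) ^ 2)" by (simp add: power2_eq_square del: of_nat_Suc)
      also have "\<dots> \<le> C * (1 / real (Suc n) ^ 2)" by (intro mult_right_mono C) auto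
      finally show ?thesis by simp
    qed
    ultimately show ?thesis unfolding dirichlet_weight_def t using assms(2) t(2) by auto
  qed
qed

text \<open>Taking the constant 1 for \<open>F\<close> turns the results above into Dirichlet's
  test: convergence and bounded partial sums.\<close>

lemma slowly_varying_const: "slowly_varying (\<lambda>K n. c)"
  unfolding slowly_varying_def by (rule exI[of _ "norm c"]) auto

lemma dirichlet_weight_summable: "dirichlet_weight y d \<Longrightarrow> summable (\<lambda>n. y ^ n * d n)"
  using slowly_varying_limit(2)[OF _ slowly_varying_const[of 1], of y d "\<lambda>_. 1"] by simp

lemma dirichlet_weight_bounded:
  assumes "dirichlet_weight y d"
  shows "\<exists>C. \<forall>N. norm (\<Sum>n<N. y ^ n * d n) \<le> C"
proof -
  obtain c where c: "\<And>M N. norm (\<Sum>n=M..<N. y ^ n * d n * 1) \<le> c / sqrt (real (Suc M))"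
    using slowly_varying_tail_bound[OF assms slowly_varying_const[of 1]] by blast
  then have "norm (\<Sum>n<N. y ^ n * d n) \<le> c" for N
    using c[of 0 N] by (simp add: atLeast0LessThan)
  then show ?thesis by blast
qed

lemma dirichlet_weight_cmult:
  assumes "dirichlet_weight y d" shows "dirichlet_weight y (\<lambda>n. k * d n)"
proof -
  obtain c where c: "(\<forall>n. norm (d n) \<le> c / real (Suc n) ^ 2) \<or>
     y \<noteq> 1 \<and> (\<forall>n. norm (d n) \<le> c / real (Suc n) \<and> norm (d (Suc n) - d n) \<le> c / real (Suc n) ^ 2)"
    using assms unfolding dirichlet_weight_def by blast
  have "norm (k * z) \<le> norm k * c / t" if "norm z \<le> c / t" for z t
    using mult_left_mono[OF that, of "norm k"] by (simp add: norm_mult)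
  moreover have "norm (k * z - k * w) \<le> norm k * c / t" if "norm (z - w) \<le> c / t" for z w t
    using mult_left_mono[OF that, of "norm k"] by (simp add: norm_mult flip: right_diff_distrib)
  ultimately show ?thesis using c assms unfolding dirichlet_weight_def by (intro conjI exI[of _ "norm k * c"]) auto
qed

text \<open>Two normalisations: in \<open>polylog_shift\<close> the denominator \<open>n + b\<close>
  goes with the power \<open>Suc n\<close> of \<open>y\<close>, whereas residue sums carry
  \<open>y ^ n\<close>. This is the source of the inverse roots of unity in the result.\<close>

lemma polylog_shift_sums:
  assumes "shift_bounded_below b" "norm y = 1" "t \<ge> 1" "(t, y) \<noteq> (1, 1)"
  shows "(\<lambda>n. y ^ n * (1 / (of_nat n + b) ^ t)) sums (inverse y * polylog_shift t y b)"
    and "(\<lambda>n. y ^ Suc n * (1 / (of_nat n + b) ^ t)) sums polylog_shift t y b"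
proof -
  have y: "y \<noteq> 0" using assms(2) by auto
  have "summable (\<lambda>n. y ^ n * (1 / (of_nat n + b) ^ t))"
    by (intro dirichlet_weight_summable dirichlet_weight_reciprocal_power assms)
  from sums_mult[OF summable_sums[OF this], of y]
  have *: "(\<lambda>n. y ^ Suc n * (1 / (of_nat n + b) ^ t)) sums (y * (\<Sum>n. y ^ n * (1 / (of_nat n + b) ^ t)))"
    by (simp add: mult.assoc)
  then have "polylog_shift t y b = y * (\<Sum>n. y ^ n * (1 / (of_nat n + b) ^ t))"
    unfolding polylog_shift_def by (simp add: sums_iff algebra_simps)
  with * show 1: "(\<lambda>n. y ^ Suc n * (1 / (of_nat n + b) ^ t)) sums polylog_shift t y b" by simp
  from sums_mult[OF this, of "inverse y"] y
  show "(\<lambda>n. y ^ n * (1 / (of_nat n + b) ^ t)) sums (inverse y * polylog_shift t y b)"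
    by (simp add: mult.assoc[symmetric])
qed

lemma shift_bounded_below_1: "shift_bounded_below 1"
  by (rule shift_bounded_belowI) (metis of_nat_Suc of_nat_neq_0 add.commute)

lemma polylog_eq_shift: "polylog t y = polylog_shift t y 1"
  by (simp add: polylog_def polylog_shift_def)

lemma polylog_sums:
  assumes "norm y = 1" "t \<ge> 1" "(t, y) \<noteq> (1, 1)"
  shows "(\<lambda>n. y ^ Suc n * (1 / of_nat (Suc n) ^ t)) sums polylog t y"
  using polylog_shift_sums(2)[OF shift_bounded_below_1 assms] by (simp add: polylog_eq_shift add.commute)

lemma shift_bounded_below_nonint: "a \<notin> \<int> \<Longrightarrow> shift_bounded_below a"
  by (rule shift_bounded_belowI) (metis Ints_of_nat Ints_minus add_eq_0_iff minus_minus)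

text \<open>Discrete antiderivative on all integers, normalised to 0 at 0. The negative side is
  needed because at \<open>s = -n\<close> the summation window starts at index
  \<open>-n\<close>.\<close>

definition antidiff :: "(int \<Rightarrow> complex) \<Rightarrow> int \<Rightarrow> complex" where
  "antidiff w m = (if m \<ge> 0 then \<Sum>j<nat m. w (int j) else - (\<Sum>j<nat (- m). w (- 1 - int j)))"

lemma antidiff_step: "antidiff w (m + 1) = antidiff w m + w m"
proof (cases "m \<ge> 0")
  case True
  then have "nat (m + 1) = Suc (nat m)" by simp
  with True show ?thesis by (simp add: antidiff_def)
next
  case False
  then have "nat (- m) = Suc (nat (- (m + 1)))" by simp
  with False have "antidiff w m = - (\<Sum>j<nat (- (m + 1)). w (- 1 - int j)) - w m"
    by (simp add: antidiff_def)
  with False show ?thesis by (auto simp: antidiff_def)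
qed

lemma sum_window: "(\<Sum>k\<le>K. w (int k + m)) = antidiff w (m + int K + 1) - antidiff w m"
proof (induction K)
  case 0
  then show ?case by (simp add: antidiff_step)
next
  case (Suc K)
  have "antidiff w (m + int (Suc K) + 1) = antidiff w (m + int K + 1) + w (int (Suc K) + m)"
    using antidiff_step[of w "m + int K + 1"] by (simp add: add_ac)
  then show ?case using Suc by simp
qed

text \<open>At \<open>s = m\<close> the \<open>k\<close>-th summand of the Lerch series is
  \<open>u powi (- m)\<close> times this sequence at \<open>k + m\<close>, so integer arguments only
  move a window along it.\<close>

definition lerch_term :: "complex \<Rightarrow> nat \<Rightarrow> complex \<Rightarrow> int \<Rightarrow> complex" where
  "lerch_term u p a j = u powi j / (of_int j + a) ^ p"

lemma lerch_term_bound: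
  assumes "a \<notin> \<int>" "norm u = 1" "p \<ge> 1"
  shows "\<exists>c\<ge>0. \<forall>j. norm (lerch_term u p a j) \<le> c / (1 + \<bar>real_of_int j\<bar>)"
proof -
  have "shift_bounded_below a" "shift_bounded_below (- a)" using assms(1) by (auto intro!: shift_bounded_below_nonint simp: minus_in_Ints_iff)
  then obtain c1 c2 where c1: "c1 > 0" "\<And>n. c1 * real (Suc n) \<le> norm (of_nat n + a)"
    and c2: "c2 > 0" "\<And>n. c2 * real (Suc n) \<le> norm (of_nat n + - a)" unfolding shift_bounded_below_def by blast
  define c where "c = min c1 c2"
  have c: "c > 0" using c1 c2 by (simp add: c_def)
  have lower: "c * (1 + \<bar>real_of_int j\<bar>) \<le> norm (of_int j + a)" for j
  proof (cases "j \<ge> 0")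
    case True
    then obtain n where j: "j = int n" using zero_le_imp_eq_int by blast
    have "c * real (Suc n) \<le> c1 * real (Suc n)" by (intro mult_right_mono) (auto simp: c_def)
    from order_trans[OF this c1(2)] show ?thesis by (simp add: j)
  next
    case False
    then obtain n where j: "j = - int n" by (metis linear minus_minus neg_0_le_iff_le zero_le_imp_eq_int)
    have "c * real (Suc n) \<le> c2 * real (Suc n)" by (intro mult_right_mono) (auto simp: c_def)
    from order_trans[OF this c2(2)] show ?thesis by (simp add: j norm_minus_commute)
  qed
  have "norm (lerch_term u p a j) \<le> (1 / c ^ p) / (1 + \<bar>real_of_int j\<bar>)" for j
  proof -
    have pos: "0 < norm (of_int j + a)"
      by (rule less_le_trans[OF mult_pos_pos lower]) (use c in auto)
    have "norm (lerch_term u p a j) = 1 / norm (of_int j + a) ^ p"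
      by (simp add: lerch_term_def norm_divide norm_power norm_power_int assms(2))
    also have "\<dots> \<le> 1 / (c * (1 + \<bar>real_of_int j\<bar>)) ^ p"
      using c lower[of j] pos by (intro divide_left_mono power_mono mult_pos_pos zero_less_power) auto
    also have "\<dots> = 1 / c ^ p * (1 / (1 + \<bar>real_of_int j\<bar>) ^ p)" by (simp add: power_mult_distrib)
    also have "\<dots> \<le> 1 / c ^ p * (1 / (1 + \<bar>real_of_int j\<bar>) ^ 1)"
      using c assms(3) by (intro mult_left_mono divide_left_mono power_increasing) auto
    finally show ?thesis by simp
  qed
  then show ?thesis using c by (intro exI[of _ "1 / c ^ p"]) auto
qed

text \<open>Nonnegative indices start at 0 and the finite sums at 1; the shift by one produces the
  parameter \<open>a - 1\<close> and the factor \<open>inverse u\<close>. Negative indices start at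
  -1, so there the parameter is \<open>- a\<close> without a shift.\<close>

lemma antidiff_lerch_term_pos:
  assumes "norm u = 1"
  shows "antidiff (lerch_term u p a) (int n) = (\<Sum>j<n. u ^ j * (1 / (of_nat j + a) ^ p))"
    and "antidiff (lerch_term u p a) (int n) = inverse u * zeta_shift n p u (a - 1)"
proof -
  have u: "u \<noteq> 0" using assms by auto
  show *: "antidiff (lerch_term u p a) (int n) = (\<Sum>j<n. u ^ j * (1 / (of_nat j + a) ^ p))"
    by (simp add: antidiff_def lerch_term_def)
  have "zeta_shift n p u (a - 1) = (\<Sum>j<n. u ^ Suc j / (of_nat (Suc j) + (a - 1)) ^ p)"
    unfolding zeta_shift_def One_nat_def by (rule sum.atLeast1_atMost_eq)
  also have "\<dots> = u * (\<Sum>j<n. u ^ j * (1 / (of_nat j + a) ^ p))"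
    by (simp add: sum_distrib_left)
  finally show "antidiff (lerch_term u p a) (int n) = inverse u * zeta_shift n p u (a - 1)"
    using u by (simp add: *)
qed

lemma lerch_term_neg:
  assumes "norm u = 1"
  shows "lerch_term u p a (- 1 - int j) = (-1) ^ p * (inverse u ^ Suc j / (of_nat (Suc j) + - a) ^ p)"
proof -
  have "u powi (- 1 - int j) = inverse u ^ Suc j"
  proof -
    have "- 1 - int j = - int (Suc j)" by simp
    then show ?thesis by (simp only: power_int_minus power_int_of_nat power_inverse)
  qed
  moreover have "(of_int (- 1 - int j) + a) ^ p = (-1) ^ p * (of_nat (Suc j) + - a) ^ p"
  proof -
    have "of_int (- 1 - int j) + a = (-1) * (of_nat (Suc j) + - a)" by simp
    then show ?thesis by (simp only: power_mult_distrib)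
  qed
  moreover have "z / ((-1) ^ p * y) = (-1) ^ p * (z / y)" for y z :: complex by (cases "even p") auto
  ultimately show ?thesis by (simp only: lerch_term_def)
qed

lemma antidiff_lerch_term_neg:
  assumes "norm u = 1"
  shows "antidiff (lerch_term u p a) (- int n) = - ((-1) ^ p * zeta_shift n p (inverse u) (- a))"
proof -
  have "zeta_shift n p (inverse u) (- a) = (\<Sum>j<n. inverse u ^ Suc j / (of_nat (Suc j) + - a) ^ p)"
    unfolding zeta_shift_def One_nat_def by (rule sum.atLeast1_atMost_eq)
  moreover have "antidiff (lerch_term u p a) (- int n) = - (\<Sum>j<n. lerch_term u p a (- 1 - int j))"
    by (auto simp: antidiff_def)
  ultimately show ?thesis using lerch_term_neg[OF assms] by (simp add: sum_distrib_left)
qed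

lemma antidiff_lerch_term_bounded:
  assumes "a \<notin> \<int>" "norm u = 1" "p \<ge> 1" "(p, u) \<noteq> (1, 1)"
  shows "\<exists>C. \<forall>m. norm (antidiff (lerch_term u p a) m) \<le> C"
proof -
  have u: "u \<noteq> 0" using assms(2) by auto
  have "dirichlet_weight u (\<lambda>n. 1 / (of_nat n + a) ^ p)"
    by (intro dirichlet_weight_reciprocal_power shift_bounded_below_nonint assms)
  from dirichlet_weight_bounded[OF this] obtain C1 where C1: "\<And>N. norm (\<Sum>n<N. u ^ n * (1 / (of_nat n + a) ^ p)) \<le> C1" by blast
  have "1 - a \<notin> \<int>" using assms(1) by (metis Ints_1 Ints_diff diff_diff_eq2 add_diff_cancel_left')
  \<comment> \<open>The negative indices are \<open>-1 - j\<close>: this pulls out one factor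
    \<open>inverse u\<close> and the sign, and turns the shift into \<open>1 - a\<close>.\<close>
  then have "dirichlet_weight (inverse u) (\<lambda>n. ((-1) ^ p * inverse u) * (1 / (of_nat n + (1 - a)) ^ p))"
    using assms by (intro dirichlet_weight_cmult dirichlet_weight_reciprocal_power shift_bounded_below_nonint) (auto simp: norm_inverse inverse_eq_1_iff)
  from dirichlet_weight_bounded[OF this] obtain C2 where
    C2: "\<And>N. norm (\<Sum>n<N. inverse u ^ n * ((-1) ^ p * inverse u * (1 / (of_nat n + (1 - a)) ^ p))) \<le> C2" by blast
  have "norm (antidiff (lerch_term u p a) m) \<le> max C1 C2" for m
  proof (cases "m \<ge> 0")
    case True
    then obtain n where "m = int n" using zero_le_imp_eq_int by blast
    then show ?thesis using C1[of n] by (simp add: antidiff_lerch_term_pos(1)[OF assms(2)])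
  next
    case False
    have "inverse u ^ j * ((-1) ^ p * inverse u * (1 / (of_nat j + (1 - a)) ^ p)) = lerch_term u p a (- 1 - int j)" for j
      unfolding lerch_term_neg[OF assms(2)] by (simp add: algebra_simps)
    then have "norm (\<Sum>j<nat (- m). lerch_term u p a (- 1 - int j)) \<le> C2" using C2[of "nat (- m)"] by simp
    then show ?thesis using False by (simp add: antidiff_def)
  qed
  then show ?thesis by blast
qed

text \<open>For every fixed \<open>m\<close> the right end of the window runs to infinity, so
  positive and negative integers share the same limit, the full Lerch series from index 0.\<close>

lemma antidiff_lerch_term_tendsto:
  assumes "a \<notin> \<int>" "norm u = 1" "p \<ge> 1" "(p, u) \<noteq> (1, 1)"
  shows "(\<lambda>K. antidiff (lerch_term u p a) (m + int K + 1)) \<longlonglongrightarrow> inverse u * polylog_shift p u a"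
proof -
  have "(\<lambda>n. antidiff (lerch_term u p a) (int n)) \<longlonglongrightarrow> inverse u * polylog_shift p u a"
    using polylog_shift_sums(1)[OF shift_bounded_below_nonint assms(2-4)] assms(1)
    unfolding antidiff_lerch_term_pos(1)[OF assms(2)] sums_def by blast
  moreover have "filterlim (\<lambda>K. nat (m + int K + 1)) sequentially sequentially"
    unfolding filterlim_at_top
  proof
    fix Z :: nat
    show "\<forall>\<^sub>F K in sequentially. Z \<le> nat (m + int K + 1)"
      using eventually_ge_at_top[of "nat (int Z - m)"] by eventually_elim linarith
  qed
  ultimately have "(\<lambda>K. antidiff (lerch_term u p a) (int (nat (m + int K + 1)))) \<longlonglongrightarrow> inverse u * polylog_shift p u a"
    by (rule filterlim_compose)
  moreover have "\<forall>\<^sub>F K in sequentially. antidiff (lerch_term u p a) (int (nat (m + int K + 1))) = antidiff (lerch_term u p a) (m + int K + 1)"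
    using eventually_ge_at_top[of "nat (- m)"] by eventually_elim simp
  ultimately show ?thesis by (rule Lim_transform_eventually)
qed

text \<open>A step of the window trades one end term for another. The end near \<open>m\<close>
  costs \<open>1 / (n + 1)\<close>; the far end costs at most the peak term, which is of its exact
  size at negative \<open>m\<close>. The last two claims concern the limits, where only the near end
  is left.\<close>

lemma slowly_varying_window:
  assumes "a \<notin> \<int>" "norm u = 1" "p \<ge> 1" "(p, u) \<noteq> (1, 1)"
  shows "slowly_varying (\<lambda>K n. antidiff (lerch_term u p a) (int (Suc n) + int K + 1) - antidiff (lerch_term u p a) (int (Suc n)))"
    and "slowly_varying (\<lambda>K n. antidiff (lerch_term u p a) (- int (Suc n) + int K + 1) - antidiff (lerch_term u p a) (- int (Suc n)))"
    and "slowly_varying (\<lambda>K n. antidiff (lerch_term u p a) (int (Suc n)))"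
    and "slowly_varying (\<lambda>K n. antidiff (lerch_term u p a) (- int (Suc n)))"
proof -
  let ?W = "antidiff (lerch_term u p a)"
  obtain C where C: "\<And>m. norm (?W m) \<le> C" using antidiff_lerch_term_bounded[OF assms] by blast
  obtain c where c: "c \<ge> 0" "\<And>j. norm (lerch_term u p a j) \<le> c / (1 + \<bar>real_of_int j\<bar>)"
    using lerch_term_bound[OF assms(1-3)] by blast
  have C0: "C \<ge> 0" using order_trans[OF norm_ge_zero C[of 0]] .
  \<comment> \<open>\<open>2 * C\<close> bounds a difference of two antidifferences and
    \<open>c\<close> a single term; their sum serves for all estimates.\<close>
  define B where "B = 2 * C + c"
  have B: "norm (?W i - ?W j) \<le> B" for i j
    using norm_triangle_ineq4[of "?W i" "?W j"] C[of i] C[of j] c(1) by (simp add: B_def)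
  have B': "norm (?W i) \<le> B" for i
    using C[of i] C0 c(1) by (simp add: B_def)
  have B0: "B \<ge> 0" using c(1) C0 by (simp add: B_def)
  have wB: "norm (lerch_term u p a j) \<le> B / t" if "t > 0" "t \<le> 1 + \<bar>real_of_int j\<bar>" for j t
  proof -
    have "c / (1 + \<bar>real_of_int j\<bar>) \<le> B / t" using that c(1) C0
      by (intro frac_le) (auto simp: B_def)
    then show ?thesis using c(2)[of j] by simp
  qed
  have "norm (?W (int (Suc (Suc n)) + int K + 1) - ?W (int (Suc (Suc n))) - (?W (int (Suc n) + int K + 1) - ?W (int (Suc n))))
     \<le> B / real (Suc n) + B / (1 + \<bar>real K - real (Suc n)\<bar>)" for K n
  proof -
    have "?W (int (Suc (Suc n)) + int K + 1) - ?W (int (Suc (Suc n))) - (?W (int (Suc n) + int K + 1) - ?W (int (Suc n)))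
      = lerch_term u p a (int (Suc n) + int K + 1) - lerch_term u p a (int (Suc n))"
      using antidiff_step[of "lerch_term u p a" "int (Suc n) + int K + 1"] antidiff_step[of "lerch_term u p a" "int (Suc n)"]
      by (simp add: add_ac)
    also have "norm \<dots> \<le> B / (1 + \<bar>real K - real (Suc n)\<bar>) + B / real (Suc n)"
      by (rule order_trans[OF norm_triangle_ineq4], intro add_mono wB) auto
    finally show ?thesis by simp
  qed
  then show "slowly_varying (\<lambda>K n. ?W (int (Suc n) + int K + 1) - ?W (int (Suc n)))"
    unfolding slowly_varying_def using B by blast
  have "norm (?W (- int (Suc (Suc n)) + int K + 1) - ?W (- int (Suc (Suc n))) - (?W (- int (Suc n) + int K + 1) - ?W (- int (Suc n))))
     \<le> B / real (Suc n) + B / (1 + \<bar>real K - real (Suc n)\<bar>)" for K n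
  proof -
    have "?W (- int (Suc (Suc n)) + int K + 1) - ?W (- int (Suc (Suc n))) - (?W (- int (Suc n) + int K + 1) - ?W (- int (Suc n)))
      = lerch_term u p a (- int (Suc (Suc n))) - lerch_term u p a (- int (Suc (Suc n)) + int K + 1)"
      using antidiff_step[of "lerch_term u p a" "- int (Suc (Suc n)) + int K + 1"] antidiff_step[of "lerch_term u p a" "- int (Suc (Suc n))"]
      by (simp add: add_ac)
    also have "norm \<dots> \<le> B / real (Suc n) + B / (1 + \<bar>real K - real (Suc n)\<bar>)"
      by (rule order_trans[OF norm_triangle_ineq4], intro add_mono wB) auto
    finally show ?thesis .
  qed
  then show "slowly_varying (\<lambda>K n. ?W (- int (Suc n) + int K + 1) - ?W (- int (Suc n)))"
    unfolding slowly_varying_def using B by blast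
  have "norm (?W (int (Suc (Suc n))) - ?W (int (Suc n))) \<le> B / real (Suc n) + B / (1 + \<bar>real K - real (Suc n)\<bar>)" for K n
  proof -
    have "norm (?W (int (Suc (Suc n))) - ?W (int (Suc n))) = norm (lerch_term u p a (int (Suc n)))"
      using antidiff_step[of "lerch_term u p a" "int (Suc n)"] by (simp add: add_ac)
    also have "\<dots> \<le> B / real (Suc n)" by (rule wB) auto
    finally show ?thesis using B0 by (simp add: add_increasing2)
  qed
  then show "slowly_varying (\<lambda>K n. ?W (int (Suc n)))"
    unfolding slowly_varying_def using B' by blast
  have "norm (?W (- int (Suc (Suc n))) - ?W (- int (Suc n))) \<le> B / real (Suc n) + B / (1 + \<bar>real K - real (Suc n)\<bar>)" for K n
  proof -
    have "?W (- int (Suc n)) = ?W (- int (Suc (Suc n))) + lerch_term u p a (- int (Suc (Suc n)))"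
      using antidiff_step[of "lerch_term u p a" "- int (Suc (Suc n))"] by (simp add: add_ac)
    then have "norm (?W (- int (Suc (Suc n))) - ?W (- int (Suc n))) = norm (lerch_term u p a (- int (Suc (Suc n))))"
      by simp
    also have "\<dots> \<le> B / real (Suc n)" by (rule wB) auto
    finally show ?thesis using B0 by (simp add: add_increasing2)
  qed
  then show "slowly_varying (\<lambda>K n. ?W (- int (Suc n)))"
    unfolding slowly_varying_def using B' by blast
qed

section \<open>Summation of partial fractions over the nonzero integers\<close>

text \<open>Pairing \<open>n + 1\<close> with \<open>-(n + 1)\<close> makes an ordinary series of
  the sum over the integers, with 0 omitted because it is a pole of the summand.\<close>

definition bilateral :: "complex \<Rightarrow> (complex \<Rightarrow> complex) \<Rightarrow> nat \<Rightarrow> complex" where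
  "bilateral x f n = inverse x ^ Suc n * f (of_nat (Suc n)) + x ^ Suc n * f (- of_nat (Suc n))"

lemma bilateral_add: "bilateral x (\<lambda>s. f s + g s) n = bilateral x f n + bilateral x g n"
  by (simp add: bilateral_def algebra_simps)

lemma bilateral_cmult: "bilateral x (\<lambda>s. c * f s) n = c * bilateral x f n"
  by (simp add: bilateral_def algebra_simps)

lemma bilateral_sum: "bilateral x (\<lambda>s. \<Sum>i\<in>A. f i s) n = (\<Sum>i\<in>A. bilateral x (f i) n)"
  by (simp add: bilateral_def sum_distrib_left sum.distrib)

lemma bilateral_pole_part: "bilateral x (\<lambda>s. pole_part m r D (Z s)) n = pole_part m r D (\<lambda>i. bilateral x (\<lambda>s. Z s i) n)"
  unfolding pole_part_def by (simp only: bilateral_sum bilateral_cmult)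

lemma bilateral_product_poles: "bilateral x (\<lambda>s. product_poles x1 p1 x2 p2 K (Z s)) n = product_poles x1 p1 x2 p2 K (\<lambda>k i. bilateral x (\<lambda>s. Z s k i) n)"
  unfolding product_poles_def cross_poles_def by (simp only: bilateral_add bilateral_sum bilateral_cmult bilateral_pole_part)

lemma bilateral_reciprocal_sums:
  assumes "norm x = 1" "x \<noteq> 1" "i \<ge> 1"
  shows "bilateral x (\<lambda>s. (1 / s) ^ i) sums (polylog i (inverse x) + (-1) ^ i * polylog i x)"
proof -
  have S: "(\<lambda>n. inverse x ^ Suc n * (1 / of_nat (Suc n) ^ i) + (-1) ^ i * (x ^ Suc n * (1 / of_nat (Suc n) ^ i)))
     sums (polylog i (inverse x) + (-1) ^ i * polylog i x)"
    using assms by (intro sums_add sums_mult polylog_sums) (auto simp: norm_inverse inverse_eq_1_iff)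
  have e: "(1 / - of_nat (Suc n) :: complex) ^ i = (-1) ^ i * (1 / of_nat (Suc n) ^ i)" for n
  proof -
    have "1 / - of_nat (Suc n) = (-1) * (1 / of_nat (Suc n) :: complex)" by (simp del: of_nat_Suc)
    then show ?thesis by (simp only: power_mult_distrib power_divide power_one)
  qed
  show ?thesis using S unfolding bilateral_def[abs_def] e by (simp only: power_one_over mult.left_commute)
qed

text \<open>Over all integers, shifting the summation index by \<open>k\<close> merely multiplies
  the sum by \<open>x ^ k\<close>, and for \<open>k = 0\<close> the sum is
  \<open>- C_coeff x a (i - 1)\<close>. The last term removes the integer 0.\<close>

lemma bilateral_shift_sums:
  assumes "norm x = 1" "x \<noteq> 1" "i \<ge> 1" "a \<notin> \<int>"
  shows "bilateral x (\<lambda>s. (1 / (s + (a + of_nat k))) ^ i) sums (- (x ^ k * C_coeff x a (i - 1)) - (1 / (a + of_nat k)) ^ i)"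
proof -
  have x: "x \<noteq> 0" using assms by auto
  \<comment> \<open>\<open>P\<close> covers the nonnegative and \<open>Q\<close> the negative
    integers; only their total has a simple form for every \<open>k\<close>.\<close>
  have "\<exists>P Q. (\<lambda>n. inverse x ^ n * (1 / (of_nat n + (a + of_nat k))) ^ i) sums P \<and>
     (\<lambda>n. x ^ Suc n * (1 / (- of_nat (Suc n) + (a + of_nat k))) ^ i) sums Q \<and> P + Q = - (x ^ k * C_coeff x a (i - 1))"
  proof (induction k)
    case 0
    have "(\<lambda>n. inverse x ^ n * (1 / (of_nat n + a)) ^ i) sums (x * polylog_shift i (inverse x) a)"
      using polylog_shift_sums(1)[of a "inverse x" i] assms
      by (auto simp: norm_inverse power_divide shift_bounded_below_nonint)
    moreover have "1 - a \<notin> \<int>" using assms(4) by (metis Ints_1 Ints_diff diff_diff_eq2 add_diff_cancel_left')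
    then have "(\<lambda>n. (-1) ^ i * (x ^ Suc n * (1 / (of_nat n + (1 - a)) ^ i))) sums ((-1) ^ i * polylog_shift i x (1 - a))"
      using assms by (intro sums_mult polylog_shift_sums(2) shift_bounded_below_nonint) auto
    moreover have "(1 / (- of_nat (Suc n) + a)) ^ i = (-1) ^ i * (1 / (of_nat n + (1 - a)) ^ i)" for n
    proof -
      have "1 / (- of_nat (Suc n) + a) = (-1) * (1 / (of_nat n + (1 - a)))"
        by (simp add: minus_divide_right del: divide_minus_right)
      then show ?thesis by (simp only: power_mult_distrib power_divide power_one)
    qed
    moreover have "x * polylog_shift i (inverse x) a + (-1) ^ i * polylog_shift i x (1 - a) = - C_coeff x a (i - 1)"
      using assms(3) by (cases i) (auto simp: C_coeff_def)
    ultimately show ?case by (intro exI conjI) (simp_all add: mult_ac)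
  next
    case (Suc k)
    then obtain P Q where P: "(\<lambda>n. inverse x ^ n * (1 / (of_nat n + (a + of_nat k))) ^ i) sums P"
      and Q: "(\<lambda>n. x ^ Suc n * (1 / (- of_nat (Suc n) + (a + of_nat k))) ^ i) sums Q"
      and PQ: "P + Q = - (x ^ k * C_coeff x a (i - 1))" by blast
    \<comment> \<open>The value at 0, which crosses from the nonnegative to the negative half when
      \<open>k\<close> increases.\<close>
    define e where "e = (1 / (a + of_nat k)) ^ i"
    have "(\<lambda>n. inverse x ^ Suc n * (1 / (of_nat (Suc n) + (a + of_nat k))) ^ i) sums (P - e)"
      using P by (subst sums_Suc_iff) (simp add: e_def)
    from sums_mult[OF this, of x] have P': "(\<lambda>n. x * (inverse x ^ Suc n * (1 / (of_nat (Suc n) + (a + of_nat k))) ^ i)) sums (x * (P - e))" .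
    moreover have xx: "x * (inverse x ^ Suc n * (1 / (of_nat (Suc n) + (a + of_nat k))) ^ i) =
        inverse x ^ n * (1 / (of_nat n + (a + of_nat (Suc k)))) ^ i" for n
      using x by (simp add: add_ac mult.assoc[symmetric])
    moreover have Q': "(\<lambda>n. x ^ Suc n * (1 / (- of_nat (Suc n) + (a + of_nat (Suc k)))) ^ i) sums (x * Q + x * e)"
    proof -
      have "(\<lambda>n. x ^ Suc (Suc n) * (1 / (- of_nat (Suc (Suc n)) + (a + of_nat (Suc k)))) ^ i) sums (x * Q)"
      proof -
        have "- of_nat (Suc (Suc n)) + (a + of_nat (Suc k)) = - of_nat (Suc n) + (a + of_nat k)" for n
          by simp
        then show ?thesis using sums_mult[OF Q, of x] by (simp only: power_Suc mult.assoc)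
      qed
      from sums_Suc[OF this] show ?thesis by (simp add: e_def)
    qed
    moreover have "x * (P - e) + (x * Q + x * e) = - (x ^ Suc k * C_coeff x a (i - 1))"
      using arg_cong[OF PQ, of "\<lambda>z. x * z"] by (simp add: algebra_simps)
    ultimately show ?case using P'[unfolded xx] Q' by blast
  qed
  then obtain P Q where P: "(\<lambda>n. inverse x ^ n * (1 / (of_nat n + (a + of_nat k))) ^ i) sums P"
      and Q: "(\<lambda>n. x ^ Suc n * (1 / (- of_nat (Suc n) + (a + of_nat k))) ^ i) sums Q"
      and PQ: "P + Q = - (x ^ k * C_coeff x a (i - 1))" by blast
  have "(\<lambda>n. inverse x ^ Suc n * (1 / (of_nat (Suc n) + (a + of_nat k))) ^ i) sums (P - (1 / (a + of_nat k)) ^ i)"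
    using P by (subst sums_Suc_iff) simp
  from sums_add[OF this Q] show ?thesis
    unfolding bilateral_def[abs_def] PQ[symmetric] by (simp add: algebra_simps)
qed

section \<open>Principal parts at 0 and at the shifted poles\<close>

lemma partial_fraction_powers:
  fixes s \<alpha> :: complex
  assumes "s \<noteq> 0" "\<alpha> \<noteq> 0" "s + \<alpha> \<noteq> 0" "q + m > 0"
  shows "(1 / s) ^ q * (1 / (s + \<alpha>)) ^ m =
     pole_part q m (1 / \<alpha>) (\<lambda>i. (1 / s) ^ i) + pole_part m q (- (1 / \<alpha>)) (\<lambda>i. (1 / (s + \<alpha>)) ^ i)"
proof -
  have SU: "1 / s * (1 / (s + \<alpha>)) = 1 / \<alpha> * (1 / s - 1 / (s + \<alpha>))"
    using assms by (simp add: field_simps)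
  have "(1 / s) ^ Suc m * (1 / (s + \<alpha>)) ^ Suc n =
     1 / \<alpha> * ((1 / s) ^ Suc m * (1 / (s + \<alpha>)) ^ n - (1 / s) ^ m * (1 / (s + \<alpha>)) ^ Suc n)" for m n
  proof -
    have "(1 / s) ^ Suc m * (1 / (s + \<alpha>)) ^ Suc n = (1 / s) ^ m * (1 / (s + \<alpha>)) ^ n * (1 / s * (1 / (s + \<alpha>)))"
      by (simp only: power_Suc mult_ac)
    then show ?thesis unfolding SU by (simp only: power_Suc right_diff_distrib mult_ac)
  qed
  from partial_fraction[of "\<lambda>m n. (1 / s) ^ m * (1 / (s + \<alpha>)) ^ n", OF this assms(4)] show ?thesis by simp
qed

lemma sum_choose_column: "q \<ge> 1 \<Longrightarrow> m \<ge> 1 \<Longrightarrow> (\<Sum>i<m. (q + i - 1) choose i) = (m + q - 1) choose q"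
proof -
  assume "q \<ge> 1" "m \<ge> 1"
  then obtain r l where q: "q = Suc r" and m: "m = Suc l" by (metis Suc_pred' less_eq_Suc_le One_nat_def)
  have "(\<Sum>i<m. (q + i - 1) choose i) = (\<Sum>i\<le>l. (r + i) choose i)"
    by (simp add: q m lessThan_Suc_atMost)
  also have "\<dots> = Suc (r + l) choose l" by (rule sum_choose_lower)
  also have "\<dots> = Suc (r + l) choose (Suc (r + l) - l)" by (rule binomial_symmetric) simp
  also have "Suc (r + l) - l = q" by (simp add: q)
  finally show ?thesis by (simp add: q m add.commute)
qed

text \<open>Near 0, the function s^(-q) (s + \<alpha>)^(-m) minus its principal part at 0 is the
  principal part at -\<alpha>. Its value at 0 is therefore the constant Laurent coefficient, i.e.
  the \<open>q\<close>-th Taylor coefficient of (s + \<alpha>)^(-m).\<close>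

lemma pole_part_powers_eq_recip_fps_nth:
  assumes "\<alpha> \<noteq> 0" "q \<ge> 1" "m \<ge> 1"
  shows "pole_part m q (- (1 / \<alpha>)) (\<lambda>i. (1 / \<alpha>) ^ i) = fps_nth (recip_fps \<alpha> ^ m) q"
proof -
  have "pole_part m q (- (1 / \<alpha>)) (\<lambda>i. (1 / \<alpha>) ^ i) = (\<Sum>i<m. (-1) ^ q * (1 / \<alpha>) ^ (m + q) * of_nat ((q + i - 1) choose i))"
    unfolding pole_part_def
  proof (rule sum.cong[OF refl])
    fix i assume "i \<in> {..<m}"
    then have "(1 / \<alpha>) ^ (m + q) = (1 / \<alpha>) ^ (q + i) * (1 / \<alpha>) ^ (m - i)"
      by (simp add: add.commute flip: power_add)
    moreover have "(- (1 / \<alpha>)) ^ (q + i) = (-1) ^ q * (-1) ^ i * (1 / \<alpha>) ^ (q + i)"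
      by (subst power_minus) (simp add: power_add)
    moreover have "(-1) ^ i * (-1) ^ i = (1::complex)" by (simp flip: power_mult_distrib)
    ultimately show "of_nat ((q + i - 1) choose i) * (-1) ^ i * (- (1 / \<alpha>)) ^ (q + i) * (1 / \<alpha>) ^ (m - i)
        = (-1) ^ q * (1 / \<alpha>) ^ (m + q) * of_nat ((q + i - 1) choose i)"
      by (simp add: mult_ac)
  qed
  also have "\<dots> = (-1) ^ q * (1 / \<alpha>) ^ (m + q) * of_nat ((m + q - 1) choose q)"
    unfolding sum_distrib_left[symmetric] of_nat_sum[symmetric] sum_choose_column[OF assms(2,3)] ..
  finally show ?thesis by (simp add: recip_fps_nth[OF assms(1)] mult_ac)
qed

lemma nonint_add_of_int: "a \<notin> \<int> \<Longrightarrow> of_int m + (a + of_nat k) \<noteq> (0::complex)"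
proof
  assume "a \<notin> \<int>" "of_int m + (a + of_nat k) = 0"
  then have "a = of_int (- m - int k)" by (simp add: algebra_simps add_eq_0_iff2)
  with \<open>a \<notin> \<int>\<close> show False by (metis Ints_of_int)
qed

lemma nonint_add_of_nat: "a \<notin> \<int> \<Longrightarrow> a + of_nat k \<noteq> (0::complex)"
  using nonint_add_of_int[of a 0 k] by simp

text \<open>Minus the weighted sum over all integers, 0 included, of the principal part at
  \<open>-a - k\<close> of s^(-q) (s + a + k)^(-m).\<close>

definition pole_term :: "complex \<Rightarrow> complex \<Rightarrow> nat \<Rightarrow> nat \<Rightarrow> nat \<Rightarrow> complex" where
  "pole_term x a q k m = x ^ k * pole_part m q (- (1 / (a + of_nat k))) (\<lambda>i. C_coeff x a (i - 1))"

text \<open>The contributions are, in order: the pole at 0, the omitted integer 0, and the pole at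
  \<open>-a - k\<close>.\<close>

lemma bilateral_single_sums:
  assumes "norm x = 1" "x \<noteq> 1" "a \<notin> \<int>" "q \<ge> 1" "m \<ge> 1"
  shows "bilateral x (\<lambda>s. (1 / s) ^ q * (1 / (s + (a + of_nat k))) ^ m) sums
    ((\<Sum>j<q. (polylog (q - j) (inverse x) + (-1) ^ (q - j) * polylog (q - j) x) * fps_nth (recip_fps (a + of_nat k) ^ m) j)
      - fps_nth (recip_fps (a + of_nat k) ^ m) q - pole_term x a q k m)"
proof -
  define \<alpha> where "\<alpha> = a + of_nat k"
  have \<alpha>: "\<alpha> \<noteq> 0" unfolding \<alpha>_def by (rule nonint_add_of_nat[OF assms(3)])
  define T where "T i = polylog i (inverse x) + (-1) ^ i * polylog i x" for i
  have nz: "of_nat (Suc n) + \<alpha> \<noteq> 0" "- of_nat (Suc n) + \<alpha> \<noteq> 0" for n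
    using nonint_add_of_int[OF assms(3), of "int (Suc n)" k] nonint_add_of_int[OF assms(3), of "- int (Suc n)" k]
    by (simp_all add: \<alpha>_def)
  have "bilateral x (\<lambda>s. (1 / s) ^ q * (1 / (s + \<alpha>)) ^ m) =
    (\<lambda>n. pole_part q m (1 / \<alpha>) (\<lambda>i. bilateral x (\<lambda>s. (1 / s) ^ i) n) + pole_part m q (- (1 / \<alpha>)) (\<lambda>i. bilateral x (\<lambda>s. (1 / (s + \<alpha>)) ^ i) n))"
  proof
    fix n
    have "bilateral x (\<lambda>s. (1 / s) ^ q * (1 / (s + \<alpha>)) ^ m) n =
      bilateral x (\<lambda>s. pole_part q m (1 / \<alpha>) (\<lambda>i. (1 / s) ^ i) + pole_part m q (- (1 / \<alpha>)) (\<lambda>i. (1 / (s + \<alpha>)) ^ i)) n"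
      unfolding bilateral_def using nz[of n] \<alpha> assms(4)
      by (subst (1 2) partial_fraction_powers) (auto simp del: of_nat_Suc)
    then show "bilateral x (\<lambda>s. (1 / s) ^ q * (1 / (s + \<alpha>)) ^ m) n =
      pole_part q m (1 / \<alpha>) (\<lambda>i. bilateral x (\<lambda>s. (1 / s) ^ i) n) + pole_part m q (- (1 / \<alpha>)) (\<lambda>i. bilateral x (\<lambda>s. (1 / (s + \<alpha>)) ^ i) n)"
      by (simp only: bilateral_add bilateral_pole_part)
  qed
  note e1 = this
  have e2: "(\<lambda>n. pole_part q m (1 / \<alpha>) (\<lambda>i. bilateral x (\<lambda>s. (1 / s) ^ i) n) + pole_part m q (- (1 / \<alpha>)) (\<lambda>i. bilateral x (\<lambda>s. (1 / (s + \<alpha>)) ^ i) n))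
     sums (pole_part q m (1 / \<alpha>) T + pole_part m q (- (1 / \<alpha>)) (\<lambda>i. - (x ^ k * C_coeff x a (i - 1)) - (1 / \<alpha>) ^ i))"
    unfolding T_def \<alpha>_def using assms
    by (intro sums_add pole_part_sums bilateral_reciprocal_sums bilateral_shift_sums) auto
  \<comment> \<open>The coefficients of the principal part at 0 are by construction the Taylor
    coefficients of the other factor.\<close>
  have e3: "pole_part q m (1 / \<alpha>) T = (\<Sum>j<q. T (q - j) * fps_nth (recip_fps \<alpha> ^ m) j)"
    unfolding pole_part_def recip_fps_nth[OF \<alpha>] by (simp add: mult_ac)
  have e4: "pole_part m q (- (1 / \<alpha>)) (\<lambda>i. - (x ^ k * C_coeff x a (i - 1)) - (1 / \<alpha>) ^ i) =
     - pole_term x a q k m - fps_nth (recip_fps \<alpha> ^ m) q"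
    unfolding pole_part_diff pole_part_powers_eq_recip_fps_nth[OF \<alpha> assms(4,5)]
    using pole_part_cmult[of m q _ "- (x ^ k)"] by (simp add: pole_term_def \<alpha>_def)
  have "A + (- B - C) = A - C - B" for A B C :: complex by simp
  then show ?thesis using e2 unfolding e3 e4 e1[symmetric] by (simp only: T_def \<alpha>_def)
qed

definition lerch_trunc :: "complex \<Rightarrow> nat \<Rightarrow> complex \<Rightarrow> nat \<Rightarrow> complex \<Rightarrow> complex" where
  "lerch_trunc u p a K s = (\<Sum>k\<le>K. u ^ k / (s + a + of_nat k) ^ p)"

text \<open>The \<open>j\<close>-th Taylor coefficient of \<open>lerch_trunc\<close> at 0, for
  nonintegral \<open>a\<close>.\<close>

definition lerch_coeff :: "complex \<Rightarrow> nat \<Rightarrow> complex \<Rightarrow> nat \<Rightarrow> nat \<Rightarrow> complex" where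
  "lerch_coeff u p a K j = (\<Sum>k\<le>K. u ^ k * fps_nth (recip_fps (a + of_nat k) ^ p) j)"

text \<open>The sums for single poles are inserted into the linear expression
  \<open>product_poles\<close>. The Taylor parts reassemble into Cauchy products; only the
  \<open>C_coeff\<close> parts keep their partial fraction form.\<close>

lemma truncated_identity:
  assumes "norm x = 1" "x \<noteq> 1" "a \<notin> \<int>" "q \<ge> 1" "p1 \<ge> 1" "p2 \<ge> 1"
  shows "bilateral x (\<lambda>s. (1 / s) ^ q * (lerch_trunc x1 p1 a K s * lerch_trunc x2 p2 a K s)) sums
    ((\<Sum>j<q. (polylog (q - j) (inverse x) + (-1) ^ (q - j) * polylog (q - j) x)
         * (\<Sum>i\<le>j. lerch_coeff x1 p1 a K i * lerch_coeff x2 p2 a K (j - i)))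
      - (\<Sum>i\<le>q. lerch_coeff x1 p1 a K i * lerch_coeff x2 p2 a K (q - i))
      - product_poles x1 p1 x2 p2 K (pole_term x a q))"
proof -
  have prod: "lerch_trunc x1 p1 a K (of_int s) * lerch_trunc x2 p2 a K (of_int s)
      = product_poles x1 p1 x2 p2 K (\<lambda>k i. (1 / (of_int s + (a + of_nat k))) ^ i)" for s
    using product_poles_complex[of "of_int s" a p1 p2 x1 K x2] nonint_add_of_int[OF assms(3), of s] assms(5)
    by (simp only: lerch_trunc_def add.assoc power_one_over[symmetric]) simp
  have "bilateral x (\<lambda>s. (1 / s) ^ q * (lerch_trunc x1 p1 a K s * lerch_trunc x2 p2 a K s)) =
    (\<lambda>n. product_poles x1 p1 x2 p2 K (\<lambda>k i. bilateral x (\<lambda>s. (1 / s) ^ q * (1 / (s + (a + of_nat k))) ^ i) n))"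
  proof
    fix n
    have "bilateral x (\<lambda>s. (1 / s) ^ q * (lerch_trunc x1 p1 a K s * lerch_trunc x2 p2 a K s)) n =
       bilateral x (\<lambda>s. (1 / s) ^ q * product_poles x1 p1 x2 p2 K (\<lambda>k i. (1 / (s + (a + of_nat k))) ^ i)) n"
      unfolding bilateral_def using prod[of "int (Suc n)"] prod[of "- int (Suc n)"] by simp
    also have "\<dots> = bilateral x (\<lambda>s. product_poles x1 p1 x2 p2 K (\<lambda>k i. (1 / s) ^ q * (1 / (s + (a + of_nat k))) ^ i)) n"
      by (simp only: product_poles_cmult)
    finally show "bilateral x (\<lambda>s. (1 / s) ^ q * (lerch_trunc x1 p1 a K s * lerch_trunc x2 p2 a K s)) n =
      product_poles x1 p1 x2 p2 K (\<lambda>k i. bilateral x (\<lambda>s. (1 / s) ^ q * (1 / (s + (a + of_nat k))) ^ i) n)"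
      by (simp only: bilateral_product_poles)
  qed
  moreover have "(\<lambda>n. product_poles x1 p1 x2 p2 K (\<lambda>k i. bilateral x (\<lambda>s. (1 / s) ^ q * (1 / (s + (a + of_nat k))) ^ i) n)) sums
    product_poles x1 p1 x2 p2 K (\<lambda>k i. (\<Sum>j<q. (polylog (q - j) (inverse x) + (-1) ^ (q - j) * polylog (q - j) x) * fps_nth (recip_fps (a + of_nat k) ^ i) j)
      - fps_nth (recip_fps (a + of_nat k) ^ i) q - pole_term x a q k i)"
    using assms by (intro product_poles_sums bilateral_single_sums) auto
  moreover have "product_poles x1 p1 x2 p2 K (\<lambda>k i. fps_nth (recip_fps (a + of_nat k) ^ i) j) =
      (\<Sum>i\<le>j. lerch_coeff x1 p1 a K i * lerch_coeff x2 p2 a K (j - i))" for j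
    unfolding lerch_coeff_def using assms by (intro product_poles_fps nonint_add_of_nat) auto
  ultimately show ?thesis by (simp only: product_poles_diff product_poles_sum product_poles_cmult)
qed

section \<open>Passage to the limit\<close>

lemma lerch_trunc_eq_window:
  assumes "norm u = 1"
  shows "lerch_trunc u p a K (of_nat (Suc n)) = inverse u ^ Suc n *
      (antidiff (lerch_term u p a) (int (Suc n) + int K + 1) - antidiff (lerch_term u p a) (int (Suc n)))"
    and "lerch_trunc u p a K (- of_nat (Suc n)) = u ^ Suc n *
      (antidiff (lerch_term u p a) (- int (Suc n) + int K + 1) - antidiff (lerch_term u p a) (- int (Suc n)))"
proof -
  have u: "u \<noteq> 0" using assms by auto
  have "lerch_trunc u p a K (of_int m) = u powi (- m) * (antidiff (lerch_term u p a) (m + int K + 1) - antidiff (lerch_term u p a) m)" for m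
  proof -
    have "u ^ k / (of_int m + a + of_nat k) ^ p = u powi (- m) * lerch_term u p a (int k + m)" for k
    proof -
      have "u ^ k = u powi (- m) * u powi (int k + m)"
        using u by (simp flip: power_int_add)
      then show ?thesis by (simp add: lerch_term_def add_ac)
    qed
    then show ?thesis by (simp add: lerch_trunc_def sum_window flip: sum_distrib_left)
  qed
  from this[of "int (Suc n)"] this[of "- int (Suc n)"]
  show "lerch_trunc u p a K (of_nat (Suc n)) = inverse u ^ Suc n *
      (antidiff (lerch_term u p a) (int (Suc n) + int K + 1) - antidiff (lerch_term u p a) (int (Suc n)))"
    and "lerch_trunc u p a K (- of_nat (Suc n)) = u ^ Suc n *
      (antidiff (lerch_term u p a) (- int (Suc n) + int K + 1) - antidiff (lerch_term u p a) (- int (Suc n)))"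
    by (simp_all only: of_int_minus of_int_of_nat_eq minus_minus power_int_minus power_int_of_nat power_inverse)
qed

lemma dirichlet_weight_reciprocal_Suc:
  assumes "norm v = 1" "q \<ge> 1" "(q, v) \<noteq> (1, 1)"
  shows "dirichlet_weight v (\<lambda>n. v * (1 / of_nat (Suc n) ^ q))"
  using dirichlet_weight_cmult[OF dirichlet_weight_reciprocal_power[OF shift_bounded_below_1 assms]] by (simp add: add.commute)

text \<open>The limit is multiplied out into four series. Slow variation of \<open>Z1\<close> and
  \<open>Z2\<close> makes each of them converge separately, which justifies the splitting.\<close>

lemma slowly_varying_product_limit:
  fixes Z1 Z2 :: "nat \<Rightarrow> complex"
  assumes slowly_varying: "slowly_varying F1" "slowly_varying F2" "slowly_varying (\<lambda>K. Z1)" "slowly_varying (\<lambda>K. Z2)"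
    and lim: "\<And>n. (\<lambda>K. F1 K n) \<longlonglongrightarrow> A1 - c1 * Z1 n" "\<And>n. (\<lambda>K. F2 K n) \<longlonglongrightarrow> A2 - c2 * Z2 n"
    and v: "norm v = 1" "q \<ge> 1" "(q, v) \<noteq> (1, 1)"
  defines "d \<equiv> \<lambda>n. v ^ Suc n * (1 / of_nat (Suc n) ^ q)"
  shows "summable (\<lambda>n. d n * (F1 K n * F2 K n))"
    and "(\<lambda>K. \<Sum>n. d n * (F1 K n * F2 K n)) \<longlonglongrightarrow>
      A1 * A2 * polylog q v - A1 * c2 * (\<Sum>n. d n * Z2 n) - A2 * c1 * (\<Sum>n. d n * Z1 n)
        + c1 * c2 * (\<Sum>n. d n * (Z1 n * Z2 n))"
proof -
  have d: "d n = v ^ n * (v * (1 / of_nat (Suc n) ^ q))" for n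
    by (simp add: d_def)
  note dirichlet_weight = dirichlet_weight_reciprocal_Suc[OF v]
  note F = slowly_varying_limit[OF dirichlet_weight slowly_varying_mult[OF slowly_varying(1,2)] tendsto_mult[OF lim], folded d]
  have Z: "summable (\<lambda>n. d n * Z n)" if "slowly_varying (\<lambda>K. Z)" for Z
    using slowly_varying_limit(2)[OF dirichlet_weight that tendsto_const] by (simp add: d)
  have s: "summable (\<lambda>n. d n * Z1 n)" "summable (\<lambda>n. d n * Z2 n)" "summable (\<lambda>n. d n * (Z1 n * Z2 n))"
    using Z slowly_varying(3,4) slowly_varying_mult[OF slowly_varying(3,4)] by auto
  have "(\<lambda>n. A1 * A2 * d n - A1 * c2 * (d n * Z2 n) - A2 * c1 * (d n * Z1 n) + c1 * c2 * (d n * (Z1 n * Z2 n))) sums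
    (A1 * A2 * polylog q v - A1 * c2 * (\<Sum>n. d n * Z2 n) - A2 * c1 * (\<Sum>n. d n * Z1 n) + c1 * c2 * (\<Sum>n. d n * (Z1 n * Z2 n)))"
    using polylog_sums[OF v] s unfolding d_def
    by (intro sums_add sums_diff sums_mult summable_sums)
  moreover have "A1 * A2 * d n - A1 * c2 * (d n * Z2 n) - A2 * c1 * (d n * Z1 n) + c1 * c2 * (d n * (Z1 n * Z2 n))
      = d n * ((A1 - c1 * Z1 n) * (A2 - c2 * Z2 n))" for n
    by (simp add: algebra_simps)
  ultimately have "(\<Sum>n. d n * ((A1 - c1 * Z1 n) * (A2 - c2 * Z2 n))) =
     A1 * A2 * polylog q v - A1 * c2 * (\<Sum>n. d n * Z2 n) - A2 * c1 * (\<Sum>n. d n * Z1 n) + c1 * c2 * (\<Sum>n. d n * (Z1 n * Z2 n))"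
    by (simp add: sums_iff)
  with F(3) show "(\<lambda>K. \<Sum>n. d n * (F1 K n * F2 K n)) \<longlonglongrightarrow>
      A1 * A2 * polylog q v - A1 * c2 * (\<Sum>n. d n * Z2 n) - A2 * c1 * (\<Sum>n. d n * Z1 n)
        + c1 * c2 * (\<Sum>n. d n * (Z1 n * Z2 n))" by simp
  show "summable (\<lambda>n. d n * (F1 K n * F2 K n))" by (rule F(1))
qed

lemma slowly_varying_cmult: "slowly_varying F \<Longrightarrow> slowly_varying (\<lambda>K n. c * F K n)"
  using slowly_varying_mult[OF slowly_varying_const[of c]] .

lemma S_tilde_single:
  "S_tilde b [p] q [u] v = (\<Sum>n. v ^ Suc n * (1 / of_nat (Suc n) ^ q) * zeta_shift (Suc n) p u b)"
  by (simp add: S_tilde_def mult_ac)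

lemma S_tilde_pair:
  "S_tilde b [p1, p2] q [u1, u2] v = (\<Sum>n. v ^ Suc n * (1 / of_nat (Suc n) ^ q) *
     (zeta_shift (Suc n) p1 u1 b * zeta_shift (Suc n) p2 u2 b))"
  by (simp add: S_tilde_def mult_ac)

lemma slowly_varying_zeta_shift:
  assumes "a \<notin> \<int>" "norm u = 1" "p \<ge> 1" "(p, u) \<noteq> (1, 1)"
  shows "slowly_varying (\<lambda>K n. zeta_shift (Suc n) p u (a - 1))"
    and "slowly_varying (\<lambda>K n. zeta_shift (Suc n) p (inverse u) (- a))"
proof -
  have u: "u \<noteq> 0" using assms by auto
  have "slowly_varying (\<lambda>K n. u * antidiff (lerch_term u p a) (int (Suc n)))"
    by (rule slowly_varying_cmult[OF slowly_varying_window(3)[OF assms]])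
  then show "slowly_varying (\<lambda>K n. zeta_shift (Suc n) p u (a - 1))"
    unfolding antidiff_lerch_term_pos(2)[OF assms(2)] using u by (simp add: mult.assoc[symmetric])
  have "slowly_varying (\<lambda>K n. - ((-1) ^ p) * antidiff (lerch_term u p a) (- int (Suc n)))"
    by (rule slowly_varying_cmult[OF slowly_varying_window(4)[OF assms]])
  moreover have "- ((-1) ^ p) * - ((-1) ^ p * z) = z" for z :: complex
    by (cases "even p") auto
  ultimately show "slowly_varying (\<lambda>K n. zeta_shift (Suc n) p (inverse u) (- a))"
    unfolding antidiff_lerch_term_neg[OF assms(2)] by (simp only:)
qed

text \<open>Positive integers carry the weight \<open>inverse y\<close> and sums with parameter
  \<open>a - 1\<close>; negative ones carry \<open>y\<close>, parameter \<open>- a\<close> and the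
  sign of s^(-q).\<close>

lemma bilateral_limit:
  assumes "norm x = 1" "a \<notin> \<int>" "norm x1 = 1" "norm x2 = 1" "p1 \<ge> 1" "p2 \<ge> 1" "q \<ge> 1"
    and "(p1, x1) \<noteq> (1, 1)" "(p2, x2) \<noteq> (1, 1)" and y: "y = x * x1 * x2" "(q, y) \<noteq> (1, 1)"
  defines "A1 \<equiv> inverse x1 * polylog_shift p1 x1 a" and "A2 \<equiv> inverse x2 * polylog_shift p2 x2 a"
  shows "(\<lambda>K. \<Sum>n. bilateral x (\<lambda>s. (1 / s) ^ q * (lerch_trunc x1 p1 a K s * lerch_trunc x2 p2 a K s)) n) \<longlonglongrightarrow>
     (A1 * A2 * polylog q (inverse y) - A1 * inverse x2 * S_tilde (a - 1) [p2] q [x2] (inverse y)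
        - A2 * inverse x1 * S_tilde (a - 1) [p1] q [x1] (inverse y)
        + inverse x1 * inverse x2 * S_tilde (a - 1) [p1, p2] q [x1, x2] (inverse y))
     + (-1) ^ q * (A1 * A2 * polylog q y - A1 * - ((-1) ^ p2) * S_tilde (- a) [p2] q [inverse x2] y
        - A2 * - ((-1) ^ p1) * S_tilde (- a) [p1] q [inverse x1] y
        + - ((-1) ^ p1) * - ((-1) ^ p2) * S_tilde (- a) [p1, p2] q [inverse x1, inverse x2] y)"
proof -
  note h1 = assms(2,3,5,8) and h2 = assms(2,4,6,9)
  have ny: "norm y = 1" "norm (inverse y) = 1" using assms by (auto simp: norm_mult norm_inverse)
  then have iy: "(q, inverse y) \<noteq> (1, 1)" using y(2) by (auto simp: inverse_eq_1_iff)
  let ?W1 = "antidiff (lerch_term x1 p1 a)" and ?W2 = "antidiff (lerch_term x2 p2 a)"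
  define P where "P K n = inverse y ^ Suc n * (1 / of_nat (Suc n) ^ q) *
     ((?W1 (int (Suc n) + int K + 1) - ?W1 (int (Suc n))) * (?W2 (int (Suc n) + int K + 1) - ?W2 (int (Suc n))))" for K n
  define Q where "Q K n = y ^ Suc n * (1 / of_nat (Suc n) ^ q) *
     ((?W1 (- int (Suc n) + int K + 1) - ?W1 (- int (Suc n))) * (?W2 (- int (Suc n) + int K + 1) - ?W2 (- int (Suc n))))" for K n
  have lp: "(\<lambda>K. antidiff (lerch_term u p a) (int (Suc n) + int K + 1) - antidiff (lerch_term u p a) (int (Suc n)))
      \<longlonglongrightarrow> inverse u * polylog_shift p u a - inverse u * zeta_shift (Suc n) p u (a - 1)"
    if "norm u = 1" "p \<ge> 1" "(p, u) \<noteq> (1, 1)" for u p n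
    unfolding antidiff_lerch_term_pos(2)[OF that(1)]
    by (intro tendsto_diff tendsto_const antidiff_lerch_term_tendsto assms that)
  have ln: "(\<lambda>K. antidiff (lerch_term u p a) (- int (Suc n) + int K + 1) - antidiff (lerch_term u p a) (- int (Suc n)))
      \<longlonglongrightarrow> inverse u * polylog_shift p u a - (- ((-1) ^ p)) * zeta_shift (Suc n) p (inverse u) (- a)"
    if "norm u = 1" "p \<ge> 1" "(p, u) \<noteq> (1, 1)" for u p n
    unfolding antidiff_lerch_term_neg[OF that(1)] mult_minus_left
    by (intro tendsto_diff tendsto_const antidiff_lerch_term_tendsto assms that)
  note lim_P = slowly_varying_product_limit[OF slowly_varying_window(1)[OF h1] slowly_varying_window(1)[OF h2] slowly_varying_zeta_shift(1)[OF h1]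
      slowly_varying_zeta_shift(1)[OF h2] lp[OF h1(2-4)] lp[OF h2(2-4)] ny(2) assms(7) iy,
      folded P_def A1_def A2_def S_tilde_single S_tilde_pair]
  note lim_Q = slowly_varying_product_limit[OF slowly_varying_window(2)[OF h1] slowly_varying_window(2)[OF h2] slowly_varying_zeta_shift(2)[OF h1]
      slowly_varying_zeta_shift(2)[OF h2] ln[OF h1(2-4)] ln[OF h2(2-4)] ny(1) assms(7) y(2),
      folded Q_def A1_def A2_def S_tilde_single S_tilde_pair]
  have "bilateral x (\<lambda>s. (1 / s) ^ q * (lerch_trunc x1 p1 a K s * lerch_trunc x2 p2 a K s)) n = P K n + (-1) ^ q * Q K n" for K n
  proof -
    have "1 / - of_nat (Suc n) = (-1) * (1 / of_nat (Suc n) :: complex)" by (simp del: of_nat_Suc)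
    then have e: "(1 / - of_nat (Suc n) :: complex) ^ q = (-1) ^ q * (1 / of_nat (Suc n) ^ q)"
      by (simp only: power_mult_distrib power_divide power_one)
    show ?thesis unfolding bilateral_def lerch_trunc_eq_window[OF assms(3)] lerch_trunc_eq_window[OF assms(4)] P_def Q_def y(1) e
      by (simp only: power_one_over power_mult_distrib inverse_mult_distrib mult_ac)
  qed
  moreover have "(\<lambda>n. P K n + (-1) ^ q * Q K n) sums ((\<Sum>n. P K n) + (-1) ^ q * (\<Sum>n. Q K n))" for K
    by (intro sums_add sums_mult summable_sums lim_P lim_Q)
  ultimately have "(\<Sum>n. bilateral x (\<lambda>s. (1 / s) ^ q * (lerch_trunc x1 p1 a K s * lerch_trunc x2 p2 a K s)) n) =
      (\<Sum>n. P K n) + (-1) ^ q * (\<Sum>n. Q K n)" for K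
    by (simp add: sums_iff)
  moreover have "(\<lambda>K. (\<Sum>n. P K n) + (-1) ^ q * (\<Sum>n. Q K n)) \<longlonglongrightarrow>
     (A1 * A2 * polylog q (inverse y) - A1 * inverse x2 * S_tilde (a - 1) [p2] q [x2] (inverse y)
        - A2 * inverse x1 * S_tilde (a - 1) [p1] q [x1] (inverse y)
        + inverse x1 * inverse x2 * S_tilde (a - 1) [p1, p2] q [x1, x2] (inverse y))
     + (-1) ^ q * (A1 * A2 * polylog q y - A1 * - ((-1) ^ p2) * S_tilde (- a) [p2] q [inverse x2] y
        - A2 * - ((-1) ^ p1) * S_tilde (- a) [p1] q [inverse x1] y
        + - ((-1) ^ p1) * - ((-1) ^ p2) * S_tilde (- a) [p1, p2] q [inverse x1, inverse x2] y)"
    by (intro tendsto_add tendsto_mult tendsto_const lim_P lim_Q)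
  ultimately show ?thesis by simp
qed

section \<open>Limits of the pole contributions\<close>

lemma sum_shifted_reciprocal_tendsto:
  assumes "a \<notin> \<int>" "norm y = 1" "t \<ge> 1" "(t, y) \<noteq> (1, 1)"
  shows "(\<lambda>K. \<Sum>k\<le>K. y ^ k * (1 / (of_nat k + a) ^ t)) \<longlonglongrightarrow> inverse y * polylog_shift t y a"
  using polylog_shift_sums(1)[OF shift_bounded_below_nonint assms(2-4)] assms(1) by (simp add: sums_def_le)

lemma lerch_coeff_tendsto:
  assumes "a \<notin> \<int>" "norm u = 1" "p \<ge> 1" "(p, u) \<noteq> (1, 1)"
  shows "(\<lambda>K. lerch_coeff u p a K j) \<longlonglongrightarrow>
    of_nat ((p + j - 1) choose j) * (-1) ^ j * (inverse u * polylog_shift (p + j) u a)"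
proof -
  have e: "lerch_coeff u p a K j = of_nat ((p + j - 1) choose j) * (-1) ^ j * (\<Sum>k\<le>K. u ^ k * (1 / (of_nat k + a) ^ (p + j)))" for K
    unfolding lerch_coeff_def recip_fps_nth[OF nonint_add_of_nat[OF assms(1)]]
    by (simp add: sum_distrib_left power_one_over add.commute mult_ac)
  have "(p + j, u) \<noteq> (1, 1)" "p + j \<ge> 1" using assms by auto
  then show ?thesis
    unfolding e by (intro tendsto_mult tendsto_const sum_shifted_reciprocal_tendsto assms)
qed

lemma zeta_fin_eq: "zeta_fin n j u = (\<Sum>k<n. u ^ Suc k * (1 / of_nat (Suc k) ^ j))"
proof -
  have "zeta_fin n j u = (\<Sum>k<n. u ^ Suc k / of_nat (Suc k) ^ j)"
    unfolding zeta_fin_def One_nat_def by (rule sum.atLeast1_atMost_eq)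
  then show ?thesis by simp
qed

lemma zeta_fin_tendsto:
  assumes "norm u = 1" "j \<ge> 1" "(j, u) \<noteq> (1, 1)"
  shows "(\<lambda>n. zeta_fin n j u) \<longlonglongrightarrow> polylog j u"
  using polylog_sums[OF assms] by (simp only: zeta_fin_eq sums_def)

text \<open>The second family changes by a term of index about \<open>K - n\<close>, again the peak
  at \<open>K\<close>; from \<open>n = K\<close> on, truncated subtraction makes it constantly
  0.\<close>

lemma slowly_varying_zeta_fin:
  assumes "norm u = 1" "j \<ge> 1" "(j, u) \<noteq> (1, 1)"
  shows "slowly_varying (\<lambda>K n. zeta_fin n j u)" and "slowly_varying (\<lambda>K n. zeta_fin (K - n) j u)"
proof -
  from zeta_fin_tendsto[OF assms] have "Bseq (\<lambda>n. zeta_fin n j u)"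
    by (intro convergent_imp_Bseq convergentI)
  then obtain C0 where C0: "\<And>n. norm (zeta_fin n j u) \<le> C0" by (auto simp: Bseq_def)
  define C where "C = max 1 C0"
  have C: "\<And>n. norm (zeta_fin n j u) \<le> C" "C \<ge> 1" using C0 by (auto simp: C_def intro: max.coboundedI2)
  have step: "norm (zeta_fin (Suc n) j u - zeta_fin n j u) \<le> C / real (Suc n)" for n
  proof -
    have "norm (zeta_fin (Suc n) j u - zeta_fin n j u) = 1 / real (Suc n) ^ j"
      by (simp add: zeta_fin_eq norm_mult norm_divide norm_power assms(1) del: of_nat_Suc power_Suc)
    also have "\<dots> \<le> 1 / real (Suc n) ^ 1"
      using assms(2) by (intro divide_left_mono power_increasing) auto
    also have "\<dots> \<le> C / real (Suc n)" using C(2) by (simp add: divide_right_mono)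
    finally show ?thesis .
  qed
  have pos: "0 \<le> C / real (Suc n)" "0 \<le> C / (1 + \<bar>real K - real (Suc n)\<bar>)" for K n
    using C(2) by auto
  show "slowly_varying (\<lambda>K n. zeta_fin n j u)"
    unfolding slowly_varying_def using C(1) step pos by (metis add_increasing2 add.commute)
  have "norm (zeta_fin (K - Suc n) j u - zeta_fin (K - n) j u) \<le> C / real (Suc n) + C / (1 + \<bar>real K - real (Suc n)\<bar>)" for K n
  proof (cases "n < K")
    case True
    then have K: "K - n = Suc (K - Suc n)" by simp
    have "norm (zeta_fin (K - Suc n) j u - zeta_fin (K - n) j u) \<le> C / real (Suc (K - Suc n))"
      using step[of "K - Suc n"] unfolding K by (simp add: norm_minus_commute)
    also have "real (Suc (K - Suc n)) = 1 + \<bar>real K - real (Suc n)\<bar>" using True by (simp add: of_nat_diff)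
    finally show ?thesis using pos(1)[of n] by linarith
  next
    case False
    then show ?thesis using pos[of n] pos(2)[of K n] by simp
  qed
  then show "slowly_varying (\<lambda>K n. zeta_fin (K - n) j u)"
    unfolding slowly_varying_def using C(1) by blast
qed

text \<open>Partial sums of a Cauchy product of two series that may both converge only
  conditionally, so Mertens' theorem does not cover them; the uniform tail bound does.\<close>

lemma convolution_tendsto:
  assumes "a \<notin> \<int>" "norm y = 1" "t \<ge> 1" "(t, y) \<noteq> (1, 1)" "norm u = 1" "j \<ge> 1" "(j, u) \<noteq> (1, 1)"
  shows "(\<lambda>K. \<Sum>k\<le>K. y ^ k * (1 / (of_nat k + a) ^ t) * zeta_fin (K - k) j u) \<longlonglongrightarrow>
    inverse y * polylog_shift t y a * polylog j u"
proof -
  have dirichlet_weight: "dirichlet_weight y (\<lambda>n. 1 / (of_nat n + a) ^ t)"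
    by (intro dirichlet_weight_reciprocal_power shift_bounded_below_nonint assms)
  have "(\<lambda>K. zeta_fin (K - n) j u) \<longlonglongrightarrow> polylog j u" for n
    by (rule filterlim_compose[OF zeta_fin_tendsto[OF assms(5-7)] filterlim_minus_const_nat_at_top])
  from slowly_varying_limit(3)[OF dirichlet_weight slowly_varying_zeta_fin(2)[OF assms(5-7)] this]
  have "(\<lambda>K. \<Sum>n. y ^ n * (1 / (of_nat n + a) ^ t) * zeta_fin (K - n) j u) \<longlonglongrightarrow>
      (\<Sum>n. y ^ n * (1 / (of_nat n + a) ^ t) * polylog j u)" .
  \<comment> \<open>The infinite sum stops by itself, since \<open>K - n = 0\<close> for
    \<open>n > K\<close> makes \<open>zeta_fin\<close> empty.\<close>
  moreover have "(\<Sum>n. y ^ n * (1 / (of_nat n + a) ^ t) * zeta_fin (K - n) j u) =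
     (\<Sum>k\<le>K. y ^ k * (1 / (of_nat k + a) ^ t) * zeta_fin (K - k) j u)" for K
    by (rule suminf_finite) (auto simp: zeta_fin_def)
  moreover have "(\<Sum>n. y ^ n * (1 / (of_nat n + a) ^ t) * polylog j u) = inverse y * polylog_shift t y a * polylog j u"
    using sums_mult2[OF polylog_shift_sums(1)[OF shift_bounded_below_nonint assms(2-4)]] assms(1) by (simp add: sums_iff)
  ultimately show ?thesis by simp
qed

lemma R_sum_tendsto:
  assumes "a \<notin> \<int>" "norm y = 1" "t \<ge> 1" "(t, y) \<noteq> (1, 1)" "norm u = 1" "j \<ge> 1" "(j, u) \<noteq> (1, 1)"
  shows "(\<lambda>K. \<Sum>k\<le>K. y ^ k * (1 / (of_nat k + a) ^ t) * zeta_fin k j u) \<longlonglongrightarrow> R_sum a j t u y"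
proof -
  have dirichlet_weight: "dirichlet_weight y (\<lambda>n. 1 / (of_nat n + a) ^ t)"
    by (intro dirichlet_weight_reciprocal_power shift_bounded_below_nonint assms)
  have s: "summable (\<lambda>n. y ^ n * (1 / (of_nat n + a) ^ t) * zeta_fin n j u)"
    by (rule slowly_varying_limit(2)[OF dirichlet_weight slowly_varying_zeta_fin(1)[OF assms(5-7)]]) simp
  have "R_sum a j t u y = (\<Sum>n. y ^ Suc n * (1 / (of_nat (Suc n) + a) ^ t) * zeta_fin (Suc n) j u)"
    by (simp add: R_sum_def mult_ac)
  \<comment> \<open>The extra term at index 0 vanishes because \<open>zeta_fin 0\<close> is
    empty.\<close>
  also have "\<dots> = (\<Sum>n. y ^ n * (1 / (of_nat n + a) ^ t) * zeta_fin n j u)"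
    using suminf_split_head[OF s] by (simp add: zeta_fin_def)
  finally show ?thesis using summable_sums[OF s] by (simp add: sums_def_le)
qed

text \<open>With d the distance of \<open>l\<close> from \<open>k\<close>, the range
  \<open>l > k\<close> gives the first finite sum and \<open>l < k\<close> the second, where
  \<open>u\<close> is inverted and the sign appears.\<close>

lemma sum_reciprocal_differences:
  assumes "norm u = 1" "k \<le> K"
  shows "(\<Sum>l\<in>{..K}-{k}. u ^ l * (1 / (of_nat l - of_nat k)) ^ t) =
    u ^ k * (zeta_fin (K - k) t u + (-1) ^ t * zeta_fin k t (inverse u))"
proof -
  have u: "u \<noteq> 0" using assms by auto
  have split: "{..K} - {k} = {..<k} \<union> {k<..K}" using assms(2) by auto
  have "(\<Sum>l\<in>{..K}-{k}. u ^ l * (1 / (of_nat l - of_nat k)) ^ t) =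
     (\<Sum>l\<in>{..<k}. u ^ l * (1 / (of_nat l - of_nat k)) ^ t) + (\<Sum>l\<in>{k<..K}. u ^ l * (1 / (of_nat l - of_nat k)) ^ t)"
    unfolding split by (rule sum.union_disjoint) auto
  also have "(\<Sum>l\<in>{k<..K}. u ^ l * (1 / (of_nat l - of_nat k)) ^ t) = (\<Sum>d=1..K-k. u ^ k * (u ^ d / of_nat d ^ t))"
    by (rule sum.reindex_bij_witness[of _ "\<lambda>d. k + d" "\<lambda>l. l - k"])
      (auto simp: of_nat_diff power_one_over power_add[symmetric])
  also have "(\<Sum>l\<in>{..<k}. u ^ l * (1 / (of_nat l - of_nat k)) ^ t) = (\<Sum>d=1..k. u ^ k * ((-1) ^ t * (inverse u ^ d / of_nat d ^ t)))"
  proof (rule sum.reindex_bij_witness[of _ "\<lambda>d. k - d" "\<lambda>l. k - l"])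
    fix l assume l: "l \<in> {..<k}"
    have "u ^ k = u ^ l * u ^ (k - l)" using l by (simp flip: power_add)
    then have 1: "u ^ k * inverse u ^ (k - l) = u ^ l" using u by (simp add: power_inverse)
    have "1 / (of_nat l - of_nat k) = (-1) * (1 / of_nat (k - l) :: complex)"
      using l by (simp add: of_nat_diff minus_divide_right del: divide_minus_right)
    then have 2: "(1 / (of_nat l - of_nat k) :: complex) ^ t = (-1) ^ t * (1 / of_nat (k - l) ^ t)"
      by (simp only: power_mult_distrib power_divide power_one)
    show "u ^ k * ((-1) ^ t * (inverse u ^ (k - l) / of_nat (k - l) ^ t)) = u ^ l * (1 / (of_nat l - of_nat k)) ^ t"
      unfolding 2 1[symmetric] by simp
  qed auto
  finally show ?thesis
    by (simp add: zeta_fin_def sum_distrib_left algebra_simps)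
qed

lemma pole_term_eq:
  "pole_term x a q k m = x ^ k * (\<Sum>i<m. (-1) ^ q * of_nat ((q + i - 1) choose i) * C_coeff x a (m - i - 1)
     * (1 / (of_nat k + a) ^ (q + i)))"
proof -
  have "(-1) ^ i * (- z) ^ (q + i) = (-1) ^ q * z ^ (q + i)" for i and z :: complex
  proof -
    have "(-1) ^ i * (- z) ^ (q + i) = ((-1) ^ i * (-1) ^ i) * (-1) ^ q * z ^ (q + i)"
      by (subst power_minus) (simp add: power_add mult_ac)
    then show ?thesis by (simp flip: power_mult_distrib)
  qed
  then have "of_nat b * (-1) ^ i * (- (1 / (a + of_nat k))) ^ (q + i) * c =
     (-1) ^ q * of_nat b * c * (1 / (of_nat k + a) ^ (q + i))" for b i and c :: complex
    by (simp add: mult.assoc power_one_over add.commute)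
  then show ?thesis by (simp add: pole_term_def pole_part_def)
qed

text \<open>The sum over \<open>l\<close> is carried out for fixed \<open>k\<close>. Its factor
  \<open>x2 ^ k\<close> joins \<open>x1 ^ k\<close> and the \<open>x ^ k\<close> of
  \<open>pole_term\<close>, so that \<open>x * x1 * x2\<close> is the base of the remaining
  sum.\<close>

lemma cross_poles_pole_term:
  assumes "norm x2 = 1"
  shows "cross_poles x1 p1 x2 p2 K (pole_term x a q) =
    (\<Sum>i<p1. \<Sum>j<p1-i. of_nat ((p2 + i - 1) choose i) * ((-1) ^ q * of_nat ((q + j - 1) choose j) * C_coeff x a (p1 - i - j - 1)) *
      ((-1) ^ i * (\<Sum>k\<le>K. (x * x1 * x2) ^ k * (1 / (of_nat k + a) ^ (q + j)) * zeta_fin (K - k) (p2 + i) x2)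
       + (-1) ^ p2 * (\<Sum>k\<le>K. (x * x1 * x2) ^ k * (1 / (of_nat k + a) ^ (q + j)) * zeta_fin k (p2 + i) (inverse x2))))"
proof -
  define b where "b i = (of_nat ((p2 + i - 1) choose i) :: complex)" for i
  define c where "c i j = (-1) ^ q * of_nat ((q + j - 1) choose j) * C_coeff x a (p1 - i - j - 1)" for i j
  define r where "r k j = 1 / (of_nat k + a) ^ (q + j)" for k j
  define y where "y = x * x1 * x2"
  have summand: "x1 ^ k * (\<Sum>l\<in>{..K}-{k}. x2 ^ l * pole_part p1 p2 (1 / (of_nat l - of_nat k)) (pole_term x a q k)) =
     (\<Sum>i<p1. \<Sum>j<p1-i. b i * c i j * ((-1) ^ i * (y ^ k * r k j * zeta_fin (K - k) (p2 + i) x2)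
        + (-1) ^ p2 * (y ^ k * r k j * zeta_fin k (p2 + i) (inverse x2))))" if "k \<le> K" for k
  proof -
    have "(\<Sum>l\<in>{..K}-{k}. x2 ^ l * pole_part p1 p2 (1 / (of_nat l - of_nat k)) (pole_term x a q k)) =
      (\<Sum>i<p1. \<Sum>l\<in>{..K}-{k}. b i * (-1) ^ i * pole_term x a q k (p1 - i) * (x2 ^ l * (1 / (of_nat l - of_nat k)) ^ (p2 + i)))"
      unfolding pole_part_def sum_distrib_left b_def by (subst sum.swap) (simp add: mult_ac)
    also have "\<dots> = (\<Sum>i<p1. b i * (-1) ^ i * pole_term x a q k (p1 - i) *
        (x2 ^ k * (zeta_fin (K - k) (p2 + i) x2 + (-1) ^ (p2 + i) * zeta_fin k (p2 + i) (inverse x2))))"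
      unfolding sum_distrib_left[symmetric] sum_reciprocal_differences[OF assms that] ..
    also have "\<dots> = (\<Sum>i<p1. b i * (-1) ^ i * (x ^ k * (\<Sum>j<p1-i. c i j * r k j)) *
        (x2 ^ k * (zeta_fin (K - k) (p2 + i) x2 + (-1) ^ (p2 + i) * zeta_fin k (p2 + i) (inverse x2))))"
      unfolding pole_term_eq c_def r_def ..
    finally have "x1 ^ k * (\<Sum>l\<in>{..K}-{k}. x2 ^ l * pole_part p1 p2 (1 / (of_nat l - of_nat k)) (pole_term x a q k)) =
      (\<Sum>i<p1. \<Sum>j<p1-i. x1 ^ k * (b i * (-1) ^ i * (x ^ k * (c i j * r k j)) *
        (x2 ^ k * (zeta_fin (K - k) (p2 + i) x2 + (-1) ^ (p2 + i) * zeta_fin k (p2 + i) (inverse x2)))))"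
      by (simp only: sum_distrib_left sum_distrib_right)
    also have "\<dots> = (\<Sum>i<p1. \<Sum>j<p1-i. b i * c i j * ((-1) ^ i * (y ^ k * r k j * zeta_fin (K - k) (p2 + i) x2)
        + (-1) ^ p2 * (y ^ k * r k j * zeta_fin k (p2 + i) (inverse x2))))"
    proof (intro sum.cong refl)
      fix i j
      have "(-1) ^ i * (-1) ^ (p2 + i) = ((-1) ^ p2 :: complex)"
        by (simp add: power_add mult.left_commute flip: power_mult_distrib)
      then have s: "x1 ^ k * (B * (-1) ^ i * (x ^ k * (C * R)) * (x2 ^ k * (z + (-1) ^ (p2 + i) * w))) =
        B * C * ((-1) ^ i * (x ^ k * x1 ^ k * x2 ^ k * R * z) + (-1) ^ p2 * (x ^ k * x1 ^ k * x2 ^ k * R * w))" for B C R z w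
        by (simp add: distrib_left flip: mult.assoc)
      show "x1 ^ k * (b i * (-1) ^ i * (x ^ k * (c i j * r k j)) *
        (x2 ^ k * (zeta_fin (K - k) (p2 + i) x2 + (-1) ^ (p2 + i) * zeta_fin k (p2 + i) (inverse x2)))) =
        b i * c i j * ((-1) ^ i * (y ^ k * r k j * zeta_fin (K - k) (p2 + i) x2)
        + (-1) ^ p2 * (y ^ k * r k j * zeta_fin k (p2 + i) (inverse x2)))"
        unfolding s y_def power_mult_distrib ..
    qed
    finally show ?thesis .
  qed
  have "cross_poles x1 p1 x2 p2 K (pole_term x a q) =
     (\<Sum>k\<le>K. \<Sum>i<p1. \<Sum>j<p1-i. b i * c i j * ((-1) ^ i * (y ^ k * r k j * zeta_fin (K - k) (p2 + i) x2)
        + (-1) ^ p2 * (y ^ k * r k j * zeta_fin k (p2 + i) (inverse x2))))"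
    unfolding cross_poles_def by (intro sum.cong refl summand) simp
  also have "\<dots> = (\<Sum>i<p1. \<Sum>j<p1-i. \<Sum>k\<le>K. b i * c i j * ((-1) ^ i * (y ^ k * r k j * zeta_fin (K - k) (p2 + i) x2)
        + (-1) ^ p2 * (y ^ k * r k j * zeta_fin k (p2 + i) (inverse x2))))"
    by (subst sum.swap, rule sum.cong[OF refl], rule sum.swap)
  also have "\<dots> = (\<Sum>i<p1. \<Sum>j<p1-i. b i * c i j * ((-1) ^ i * (\<Sum>k\<le>K. y ^ k * r k j * zeta_fin (K - k) (p2 + i) x2)
        + (-1) ^ p2 * (\<Sum>k\<le>K. y ^ k * r k j * zeta_fin k (p2 + i) (inverse x2))))"
    by (simp only: sum_distrib_left[symmetric] sum.distrib)
  finally show ?thesis unfolding b_def c_def r_def y_def .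
qed

definition cross_poles_limit :: "complex \<Rightarrow> complex \<Rightarrow> nat \<Rightarrow> nat \<Rightarrow> nat \<Rightarrow> complex \<Rightarrow> complex \<Rightarrow> complex" where
  "cross_poles_limit x a q p1 p2 x2 y =
    (\<Sum>i<p1. \<Sum>j<p1-i. of_nat ((p2 + i - 1) choose i) * ((-1) ^ q * of_nat ((q + j - 1) choose j) * C_coeff x a (p1 - i - j - 1)) *
      ((-1) ^ i * (inverse y * polylog_shift (q + j) y a * polylog (p2 + i) x2)
       + (-1) ^ p2 * R_sum a (p2 + i) (q + j) (inverse x2) y))"

lemma cross_poles_tendsto:
  assumes "a \<notin> \<int>" "norm x2 = 1" "p2 \<ge> 1" "(p2, x2) \<noteq> (1, 1)" "norm y = 1" "q \<ge> 1" "(q, y) \<noteq> (1, 1)"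
    "y = x * x1 * x2"
  shows "(\<lambda>K. cross_poles x1 p1 x2 p2 K (pole_term x a q)) \<longlonglongrightarrow> cross_poles_limit x a q p1 p2 x2 y"
proof -
  have "q + j \<ge> 1" "(q + j, y) \<noteq> (1, 1)" "p2 + j \<ge> 1" "(p2 + j, x2) \<noteq> (1, 1)" "(p2 + j, inverse x2) \<noteq> (1, 1)"
    "norm (inverse x2) = 1" for j
    using assms by (auto simp: norm_inverse inverse_eq_1_iff)
  then show ?thesis
    unfolding cross_poles_pole_term[OF assms(2)] cross_poles_limit_def assms(8)[symmetric]
    by (intro tendsto_sum tendsto_mult tendsto_const tendsto_add convolution_tendsto R_sum_tendsto assms)
qed

lemma diag_tendsto:
  assumes "a \<notin> \<int>" "norm y = 1" "q \<ge> 1" "(q, y) \<noteq> (1, 1)" "y = x * x1 * x2"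
  shows "(\<lambda>K. \<Sum>k\<le>K. (x1 * x2) ^ k * pole_term x a q k m) \<longlonglongrightarrow>
    (\<Sum>j<m. (-1) ^ q * of_nat ((q + j - 1) choose j) * C_coeff x a (m - j - 1) * (inverse y * polylog_shift (q + j) y a))"
proof -
  have "(\<Sum>k\<le>K. (x1 * x2) ^ k * pole_term x a q k m) =
     (\<Sum>j<m. (-1) ^ q * of_nat ((q + j - 1) choose j) * C_coeff x a (m - j - 1) * (\<Sum>k\<le>K. y ^ k * (1 / (of_nat k + a) ^ (q + j))))" for K
  proof -
    have "(x1 * x2) ^ k * pole_term x a q k m = (\<Sum>j<m. (-1) ^ q * of_nat ((q + j - 1) choose j) * C_coeff x a (m - j - 1)
      * (y ^ k * (1 / (of_nat k + a) ^ (q + j))))" for k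
      unfolding pole_term_eq assms(5) power_mult_distrib sum_distrib_left by (simp add: mult_ac)
    then show ?thesis by (simp only: sum_distrib_left) (rule sum.swap)
  qed
  moreover have "q + j \<ge> 1" "(q + j, y) \<noteq> (1, 1)" for j using assms by auto
  ultimately show ?thesis
    by (simp only:) (intro tendsto_sum tendsto_mult tendsto_const sum_shifted_reciprocal_tendsto assms)
qed

text \<open>One sequence in \<open>K\<close> has two limits: the left side by exchanging limit and
  series, the right side through its closed form by partial fractions.\<close>

lemma limit_identity:
  assumes "norm x = 1" "x \<noteq> 1" "a \<notin> \<int>" "norm x1 = 1" "norm x2 = 1" "p1 \<ge> 1" "p2 \<ge> 1" "q \<ge> 1"
    and "(p1, x1) \<noteq> (1, 1)" "(p2, x2) \<noteq> (1, 1)" and y: "y = x * x1 * x2" "(q, y) \<noteq> (1, 1)"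
  defines "A1 \<equiv> inverse x1 * polylog_shift p1 x1 a" and "A2 \<equiv> inverse x2 * polylog_shift p2 x2 a"
  defines "t1 \<equiv> \<lambda>j. of_nat ((p1 + j - 1) choose j) * (-1) ^ j * (inverse x1 * polylog_shift (p1 + j) x1 a)"
    and "t2 \<equiv> \<lambda>j. of_nat ((p2 + j - 1) choose j) * (-1) ^ j * (inverse x2 * polylog_shift (p2 + j) x2 a)"
  shows "(A1 * A2 * polylog q (inverse y) - A1 * inverse x2 * S_tilde (a - 1) [p2] q [x2] (inverse y)
        - A2 * inverse x1 * S_tilde (a - 1) [p1] q [x1] (inverse y)
        + inverse x1 * inverse x2 * S_tilde (a - 1) [p1, p2] q [x1, x2] (inverse y))
     + (-1) ^ q * (A1 * A2 * polylog q y - A1 * - ((-1) ^ p2) * S_tilde (- a) [p2] q [inverse x2] y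
        - A2 * - ((-1) ^ p1) * S_tilde (- a) [p1] q [inverse x1] y
        + - ((-1) ^ p1) * - ((-1) ^ p2) * S_tilde (- a) [p1, p2] q [inverse x1, inverse x2] y)
    = (\<Sum>j<q. (polylog (q - j) (inverse x) + (-1) ^ (q - j) * polylog (q - j) x) * (\<Sum>i\<le>j. t1 i * t2 (j - i)))
      - (\<Sum>i\<le>q. t1 i * t2 (q - i))
      - ((\<Sum>j<p1+p2. (-1) ^ q * of_nat ((q + j - 1) choose j) * C_coeff x a (p1 + p2 - j - 1) * (inverse y * polylog_shift (q + j) y a))
         + cross_poles_limit x a q p1 p2 x2 y + cross_poles_limit x a q p2 p1 x1 y)"
    (is "?L = ?R")
proof (rule LIMSEQ_unique)
  let ?f = "\<lambda>K. \<Sum>n. bilateral x (\<lambda>s. (1 / s) ^ q * (lerch_trunc x1 p1 a K s * lerch_trunc x2 p2 a K s)) n"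
  show "?f \<longlonglongrightarrow> ?L"
    unfolding A1_def A2_def by (rule bilateral_limit; fact)
  have f: "?f = (\<lambda>K. (\<Sum>j<q. (polylog (q - j) (inverse x) + (-1) ^ (q - j) * polylog (q - j) x)
         * (\<Sum>i\<le>j. lerch_coeff x1 p1 a K i * lerch_coeff x2 p2 a K (j - i)))
      - (\<Sum>i\<le>q. lerch_coeff x1 p1 a K i * lerch_coeff x2 p2 a K (q - i))
      - product_poles x1 p1 x2 p2 K (pole_term x a q))"
    using truncated_identity[OF assms(1-3,8,6,7)] by (simp add: sums_iff)
  have ny: "norm y = 1" using assms by (simp add: norm_mult)
  have y': "y = x * x2 * x1" by (simp add: y(1) mult_ac)
  show "?f \<longlonglongrightarrow> ?R"
    unfolding f product_poles_def t1_def t2_def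
    by (intro tendsto_diff tendsto_add tendsto_sum tendsto_mult tendsto_const lerch_coeff_tendsto
        diag_tendsto[OF assms(3) ny assms(8) y(2) y(1)] cross_poles_tendsto[OF assms(3) _ _ _ ny assms(8) y(2)] assms y')
qed

section \<open>Matching the index sets and binomials of the statement\<close>

lemma sum_simplex2:
  fixes f :: "nat \<Rightarrow> nat \<Rightarrow> complex"
  assumes "p \<ge> 1"
  shows "(\<Sum>(k1, k2)\<in>{(k1, k2). k1 + k2 \<le> p - 1}. f k1 k2) = (\<Sum>i<p. \<Sum>j<p-i. f (p - i - j - 1) i)"
proof -
  have "(\<Sum>i<p. \<Sum>j<p-i. f (p - i - j - 1) i) = (\<Sum>(i, j)\<in>(SIGMA i:{..<p}. {..<p-i}). f (p - i - j - 1) i)"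
    by (rule sum.Sigma) auto
  also have "\<dots> = (\<Sum>(k1, k2)\<in>{(k1, k2). k1 + k2 \<le> p - 1}. f k1 k2)"
    using assms by (intro sum.reindex_bij_witness[of _ "\<lambda>(k1, k2). (k2, p - k1 - k2 - 1)" "\<lambda>(i, j). (p - i - j - 1, i)"]) auto
  finally show ?thesis ..
qed

lemma sum_antidiagonal2:
  fixes f :: "nat \<Rightarrow> nat \<Rightarrow> complex"
  shows "(\<Sum>(k1, k2)\<in>{(k1, k2). k1 + k2 = q}. f k1 k2) = (\<Sum>i\<le>q. f i (q - i))"
  by (rule sum.reindex_bij_witness[of _ "\<lambda>i. (i, q - i)" fst]) auto

text \<open>\<open>j = k2 + k3\<close> is the Taylor order and \<open>k1 + 1 = q - j\<close> the
  exponent left at the pole 0.\<close>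

lemma sum_antidiagonal3:
  fixes f :: "nat \<Rightarrow> nat \<Rightarrow> nat \<Rightarrow> complex"
  assumes "q \<ge> 1"
  shows "(\<Sum>(k1, k2, k3)\<in>{(k1, k2, k3). k1 + k2 + k3 = q - 1}. f k1 k2 k3) = (\<Sum>j<q. \<Sum>i\<le>j. f (q - 1 - j) i (j - i))"
proof -
  have "(\<Sum>j<q. \<Sum>i\<le>j. f (q - 1 - j) i (j - i)) = (\<Sum>(j, i)\<in>(SIGMA j:{..<q}. {..j}). f (q - 1 - j) i (j - i))"
    by (rule sum.Sigma) auto
  also have "\<dots> = (\<Sum>(k1, k2, k3)\<in>{(k1, k2, k3). k1 + k2 + k3 = q - 1}. f k1 k2 k3)"
    using assms by (intro sum.reindex_bij_witness[of _ "\<lambda>(k1, k2, k3). (k2 + k3, k2)" "\<lambda>(j, i). (q - 1 - j, i, j - i)"]) auto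
  finally show ?thesis ..
qed

lemma root_of_unity_norm: "root_of_unity u \<Longrightarrow> norm u = 1"
  unfolding root_of_unity_def by (metis norm_one norm_power norm_ge_zero power_eq_imp_eq_base power_one zero_le_one)

lemma choose_symmetric_pred: "r \<ge> 1 \<Longrightarrow> (i + r - 1) choose (r - 1) = (r + i - 1) choose i"
  using binomial_symmetric[of i "r + i - 1"] by (simp add: add.commute)

text \<open>With \<open>i = k2\<close> and \<open>j = p - 1 - k1 - k2\<close> the two sums have
  common coefficients: they are the parts \<open>l > k\<close> and \<open>l < k\<close> of one cross
  term.\<close>

lemma cross_poles_limit_eq:
  assumes "p \<ge> 1" "r \<ge> 1" "q \<ge> 1"
  shows "(-1) ^ q * (\<Sum>(k1, k2)\<in>{(k1, k2). k1 + k2 \<le> p - 1}.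
         of_nat ((k2 + r - 1) choose (r - 1)) * of_nat ((p + q - k1 - k2 - 2) choose (q - 1))
         * inverse y * C_coeff x a k1 * (-1) ^ k2 * polylog (k2 + r) u
         * polylog_shift (p + q - k1 - k2 - 1) y a)
     + (-1) ^ q * (\<Sum>(k1, k2)\<in>{(k1, k2). k1 + k2 \<le> p - 1}.
         of_nat ((k2 + r - 1) choose (r - 1)) * of_nat ((p + q - k1 - k2 - 2) choose (q - 1))
         * C_coeff x a k1 * (-1) ^ r
         * R_sum a (k2 + r) (p + q - k1 - k2 - 1) (inverse u) y)
     = cross_poles_limit x a q p r u y"
  unfolding sum_simplex2[OF assms(1)] sum_distrib_left sum.distrib[symmetric] cross_poles_limit_def
proof (intro sum.cong refl)
  fix i j assume "i \<in> {..<p}" "j \<in> {..<p - i}"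
  then have e: "p + q - (p - i - j - 1) - i - 2 = q + j - 1" "p + q - (p - i - j - 1) - i - 1 = q + j"
    using assms(3) by auto
  have c: "(q + j - 1) choose (q - 1) = (q + j - 1) choose j"
    using choose_symmetric_pred[OF assms(3), of j] by (simp add: add.commute)
  show "(-1) ^ q * (of_nat ((i + r - 1) choose (r - 1)) * of_nat ((p + q - (p - i - j - 1) - i - 2) choose (q - 1))
         * inverse y * C_coeff x a (p - i - j - 1) * (-1) ^ i * polylog (i + r) u
         * polylog_shift (p + q - (p - i - j - 1) - i - 1) y a)
     + (-1) ^ q * (of_nat ((i + r - 1) choose (r - 1)) * of_nat ((p + q - (p - i - j - 1) - i - 2) choose (q - 1))
         * C_coeff x a (p - i - j - 1) * (-1) ^ r
         * R_sum a (i + r) (p + q - (p - i - j - 1) - i - 1) (inverse u) y)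
     = of_nat ((r + i - 1) choose i) * ((-1) ^ q * of_nat ((q + j - 1) choose j) * C_coeff x a (p - i - j - 1)) *
      ((-1) ^ i * (inverse y * polylog_shift (q + j) y a * polylog (r + i) u)
       + (-1) ^ r * R_sum a (r + i) (q + j) (inverse u) y)"
    unfolding e c choose_symmetric_pred[OF assms(2)] distrib_left
    by (simp only: mult_ac add.commute[of i r])
qed

text \<open>Letters replace all analytic quantities, so that only a polynomial identity remains;
  \<open>e\<close>, \<open>e1\<close>, \<open>e2\<close> stand for the signs with exponents
  \<open>q\<close>, \<open>p1\<close>, \<open>p2\<close>.\<close>

lemma limit_identity_rearranged:
  fixes Z :: complex
  assumes "(i1 * L1 * (i2 * L2) * Pv - i1 * L1 * i2 * S2 - i2 * L2 * i1 * S1 + i1 * i2 * S12)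
     + e * (i1 * L1 * (i2 * L2) * Py - i1 * L1 * - e2 * M2 - i2 * L2 * - e1 * M1 + - e1 * - e2 * M12)
     = Z - W - (D + O12 + O21)"
  shows "e1 * e2 * e * - 1 * M12 - i1 * i2 * S12 = i1 * i2 * L1 * L2 * Pv - i1 * i2 * L1 * S2
     - i1 * i2 * L2 * S1 + e * (i1 * i2) * L1 * L2 * Py + e * e2 * i1 * L1 * M2 + e * e1 * i2 * L2 * M1
     + D + O21 + O12 + W + - Z"
  using assms by algebra

theorem theorem3p9:
  fixes x x1 x2 a :: complex and p1 p2 q :: nat
  assumes "root_of_unity x" and "root_of_unity x1" and "root_of_unity x2"
    and "x \<noteq> 1"
    and "a \<notin> \<int>"
    and "p1 \<ge> 1" and "p2 \<ge> 1" and "q \<ge> 1"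
    and "(p1, x1) \<noteq> (1, 1)" and "(p2, x2) \<noteq> (1, 1)" and "(q, x * x1 * x2) \<noteq> (1, 1)"
  shows
    "(-1) ^ (p1 + p2 + q + 1) * S_tilde (-a) [p1, p2] q [inverse x1, inverse x2] (x * x1 * x2)
     - inverse (x1 * x2) * S_tilde (a - 1) [p1, p2] q [x1, x2] (inverse (x * x1 * x2))
     = inverse (x1 * x2) * polylog_shift p1 x1 a * polylog_shift p2 x2 a
         * polylog q (inverse (x * x1 * x2))
     - inverse (x1 * x2) * polylog_shift p1 x1 a
         * S_tilde (a - 1) [p2] q [x2] (inverse (x * x1 * x2))
     - inverse (x1 * x2) * polylog_shift p2 x2 a
         * S_tilde (a - 1) [p1] q [x1] (inverse (x * x1 * x2))
     + (-1) ^ q * inverse (x1 * x2) * polylog_shift p1 x1 a * polylog_shift p2 x2 a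
         * polylog q (x * x1 * x2)
     + (-1) ^ (q + p2) * inverse x1 * polylog_shift p1 x1 a
         * S_tilde (-a) [p2] q [inverse x2] (x * x1 * x2)
     + (-1) ^ (q + p1) * inverse x2 * polylog_shift p2 x2 a
         * S_tilde (-a) [p1] q [inverse x1] (x * x1 * x2)
     + (-1) ^ q * (\<Sum>k=0..p1 + p2 - 1.
         of_nat ((p1 + p2 + q - k - 2) choose (q - 1)) * C_coeff x a k
         * inverse (x * x1 * x2) * polylog_shift (p1 + p2 + q - k - 1) (x * x1 * x2) a)
     + (-1) ^ q * (\<Sum>(k1, k2)\<in>{(k1, k2). k1 + k2 \<le> p2 - 1}.
         of_nat ((k2 + p1 - 1) choose (p1 - 1)) * of_nat ((p2 + q - k1 - k2 - 2) choose (q - 1))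
         * inverse (x * x1 * x2) * C_coeff x a k1 * (-1) ^ k2 * polylog (k2 + p1) x1
         * polylog_shift (p2 + q - k1 - k2 - 1) (x * x1 * x2) a)
     + (-1) ^ q * (\<Sum>(k1, k2)\<in>{(k1, k2). k1 + k2 \<le> p2 - 1}.
         of_nat ((k2 + p1 - 1) choose (p1 - 1)) * of_nat ((p2 + q - k1 - k2 - 2) choose (q - 1))
         * C_coeff x a k1 * (-1) ^ p1
         * R_sum a (k2 + p1) (p2 + q - k1 - k2 - 1) (inverse x1) (x * x1 * x2))
     + (-1) ^ q * (\<Sum>(k1, k2)\<in>{(k1, k2). k1 + k2 \<le> p1 - 1}.
         of_nat ((k2 + p2 - 1) choose (p2 - 1)) * of_nat ((p1 + q - k1 - k2 - 2) choose (q - 1))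
         * inverse (x * x1 * x2) * C_coeff x a k1 * (-1) ^ k2 * polylog (k2 + p2) x2
         * polylog_shift (p1 + q - k1 - k2 - 1) (x * x1 * x2) a)
     + (-1) ^ q * (\<Sum>(k1, k2)\<in>{(k1, k2). k1 + k2 \<le> p1 - 1}.
         of_nat ((k2 + p2 - 1) choose (p2 - 1)) * of_nat ((p1 + q - k1 - k2 - 2) choose (q - 1))
         * C_coeff x a k1 * (-1) ^ p2
         * R_sum a (k2 + p2) (p1 + q - k1 - k2 - 1) (inverse x2) (x * x1 * x2))
     + (\<Sum>(k1, k2)\<in>{(k1, k2). k1 + k2 = q}.
         inverse (x1 * x2) * (-1) ^ q
         * of_nat ((k1 + p1 - 1) choose (p1 - 1)) * of_nat ((k2 + p2 - 1) choose (p2 - 1))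
         * polylog_shift (k1 + p1) x1 a * polylog_shift (k2 + p2) x2 a)
     + (\<Sum>(k1, k2, k3)\<in>{(k1, k2, k3). k1 + k2 + k3 = q - 1}.
         (-1) ^ (k2 + k3)
         * of_nat ((k2 + p1 - 1) choose (p1 - 1)) * of_nat ((k3 + p2 - 1) choose (p2 - 1))
         * polylog_shift (k2 + p1) x1 a * polylog_shift (k3 + p2) x2 a * inverse (x1 * x2)
         * ((-1) ^ k1 * polylog (k1 + 1) x - polylog (k1 + 1) (inverse x)))"
proof -
  define y where "y = x * x1 * x2"
  define A1 where "A1 = inverse x1 * polylog_shift p1 x1 a"
  define A2 where "A2 = inverse x2 * polylog_shift p2 x2 a"
  define t1 where "t1 j = of_nat ((p1 + j - 1) choose j) * (-1) ^ j * (inverse x1 * polylog_shift (p1 + j) x1 a)" for j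
  define t2 where "t2 j = of_nat ((p2 + j - 1) choose j) * (-1) ^ j * (inverse x2 * polylog_shift (p2 + j) x2 a)" for j
  define T where "T j = polylog j (inverse x) + (-1) ^ j * polylog j x" for j
  define diag where "diag = (\<Sum>j<p1+p2. (-1) ^ q * of_nat ((q + j - 1) choose j) * C_coeff x a (p1 + p2 - j - 1)
      * (inverse y * polylog_shift (q + j) y a))"
  note nrm = root_of_unity_norm[OF assms(1)] root_of_unity_norm[OF assms(2)] root_of_unity_norm[OF assms(3)]
  note main = limit_identity[OF nrm(1) assms(4,5) nrm(2,3) assms(6,7,8,9,10) y_def assms(11)[folded y_def],
      folded A1_def A2_def t1_def t2_def T_def diag_def]
  have at_pole: "(-1) ^ q * (\<Sum>k=0..p1 + p2 - 1.
         of_nat ((p1 + p2 + q - k - 2) choose (q - 1)) * C_coeff x a k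
         * inverse y * polylog_shift (p1 + p2 + q - k - 1) y a) = diag"
  proof -
    define m where "m = p1 + p2"
    have m: "m \<ge> 1" using assms(6) by (simp add: m_def)
    define f where "f k = of_nat ((m + q - k - 2) choose (q - 1)) * C_coeff x a k * inverse y
      * polylog_shift (m + q - k - 1) y a" for k
    have "(\<Sum>k=0..m - 1. f k) = (\<Sum>k<m. f k)"
      using m by (intro sum.cong) auto
    \<comment> \<open>Reversal \<open>k = m - 1 - j\<close>: the \<open>j\<close>-th Taylor term of
      s^(-q) at the pole lowers its order to \<open>m - j = k + 1\<close>, which belongs to
      \<open>C_coeff x a k\<close>.\<close>
    also have "\<dots> = (\<Sum>j<m. f (m - Suc j))"
      by (rule sum.nat_diff_reindex[of f m, symmetric])
    also have "(-1) ^ q * \<dots> = (\<Sum>j<m. (-1) ^ q * of_nat ((q + j - 1) choose j) * C_coeff x a (m - j - 1)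
      * (inverse y * polylog_shift (q + j) y a))"
      unfolding sum_distrib_left
    proof (intro sum.cong refl)
      fix j assume "j \<in> {..<m}"
      then have e: "m + q - (m - j - 1) - 2 = q + j - 1" "m + q - (m - j - 1) - 1 = q + j" "m - Suc j = m - j - 1"
        using assms(8) by auto
      have c: "(q + j - 1) choose (q - 1) = (q + j - 1) choose j"
        using choose_symmetric_pred[OF assms(8), of j] by (simp add: add.commute)
      have "f (m - j - 1) = of_nat ((q + j - 1) choose j) * C_coeff x a (m - j - 1) * inverse y
          * polylog_shift (q + j) y a"
        unfolding f_def e(1,2) c ..
      then show "(-1) ^ q * f (m - Suc j) = (-1) ^ q * of_nat ((q + j - 1) choose j) * C_coeff x a (m - j - 1)
        * (inverse y * polylog_shift (q + j) y a)"
        unfolding e(3) by simp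
    qed
    finally show ?thesis by (simp only: diag_def m_def f_def)
  qed
  have zero_q: "(\<Sum>(k1, k2)\<in>{(k1, k2). k1 + k2 = q}.
         inverse (x1 * x2) * (-1) ^ q
         * of_nat ((k1 + p1 - 1) choose (p1 - 1)) * of_nat ((k2 + p2 - 1) choose (p2 - 1))
         * polylog_shift (k1 + p1) x1 a * polylog_shift (k2 + p2) x2 a) = (\<Sum>i\<le>q. t1 i * t2 (q - i))"
    unfolding sum_antidiagonal2
  proof (intro sum.cong refl)
    fix i assume "i \<in> {..q}"
    then have "(-1) ^ q = ((-1) ^ i * (-1) ^ (q - i) :: complex)" by (simp flip: power_add)
    then show "inverse (x1 * x2) * (-1) ^ q
         * of_nat ((i + p1 - 1) choose (p1 - 1)) * of_nat ((q - i + p2 - 1) choose (p2 - 1))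
         * polylog_shift (i + p1) x1 a * polylog_shift (q - i + p2) x2 a = t1 i * t2 (q - i)"
      unfolding choose_symmetric_pred[OF assms(6)] choose_symmetric_pred[OF assms(7)] t1_def t2_def
      by (simp only: inverse_mult_distrib mult_ac add.commute[of i p1] add.commute[of "q - i" p2])
  qed
  have zero_rest: "(\<Sum>(k1, k2, k3)\<in>{(k1, k2, k3). k1 + k2 + k3 = q - 1}.
         (-1) ^ (k2 + k3)
         * of_nat ((k2 + p1 - 1) choose (p1 - 1)) * of_nat ((k3 + p2 - 1) choose (p2 - 1))
         * polylog_shift (k2 + p1) x1 a * polylog_shift (k3 + p2) x2 a * inverse (x1 * x2)
         * ((-1) ^ k1 * polylog (k1 + 1) x - polylog (k1 + 1) (inverse x)))
     = - (\<Sum>j<q. T (q - j) * (\<Sum>i\<le>j. t1 i * t2 (j - i)))"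
    unfolding sum_antidiagonal3[OF assms(8)] sum_distrib_left sum_negf[symmetric]
  proof (intro sum.cong refl)
    fix j i assume ij: "j \<in> {..<q}" "i \<in> {..j}"
    then have e: "q - 1 - j + 1 = q - j" "q - j = Suc (q - 1 - j)" by auto
    \<comment> \<open>The statement has the sign with exponent \<open>k1 = q - 1 - j\<close>, one
      less than in \<open>T\<close>, so its bracket is minus \<open>T (q - j)\<close>.\<close>
    have "(-1) ^ (q - j) = - ((-1) ^ (q - 1 - j) :: complex)" unfolding e(2) by simp
    then have T: "(-1) ^ (q - 1 - j) * polylog (q - j) x - polylog (q - j) (inverse x) = - T (q - j)"
      by (simp add: T_def)
    show "(-1) ^ (i + (j - i))
         * of_nat ((i + p1 - 1) choose (p1 - 1)) * of_nat ((j - i + p2 - 1) choose (p2 - 1))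
         * polylog_shift (i + p1) x1 a * polylog_shift (j - i + p2) x2 a * inverse (x1 * x2)
         * ((-1) ^ (q - 1 - j) * polylog (q - 1 - j + 1) x - polylog (q - 1 - j + 1) (inverse x))
       = - (T (q - j) * (t1 i * t2 (j - i)))"
      unfolding choose_symmetric_pred[OF assms(6)] choose_symmetric_pred[OF assms(7)] t1_def t2_def e(1) T
      by (simp only: inverse_mult_distrib power_add mult_minus_left mult_minus_right mult_ac add.commute[of i p1] add.commute[of "j - i" p2])
  qed
  define O12 where "O12 = cross_poles_limit x a q p1 p2 x2 y"
  define O21 where "O21 = cross_poles_limit x a q p2 p1 x1 y"
  note off = cross_poles_limit_eq[OF assms(6,7,8), of y x a x2, folded O12_def]
    cross_poles_limit_eq[OF assms(7,6,8), of y x a x1, folded O21_def]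
  \<comment> \<open>Each polylogarithm sum must stand next to its \<open>R_sum\<close> partner
    before the pair can be rewritten as one cross term.\<close>
  have regroup: "l = s1 + (u1 + v1) + (u2 + v2) + w + z \<Longrightarrow> l = s1 + u1 + v1 + u2 + v2 + w + z"
    for l s1 u1 v1 u2 v2 w z :: complex by (simp add: add.assoc)
  show ?thesis
    unfolding y_def[symmetric]
    by (rule regroup, unfold off at_pole zero_q zero_rest, unfold power_add power_one_right inverse_mult_distrib,
        rule limit_identity_rearranged[OF main[unfolded A1_def A2_def, folded O12_def O21_def]])
qed

end
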